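(* Let $\Sigma$ denote the dichotomy spectrum of $(\Theta,\Phi,T^+,T^-)$ as in the context. For $(\omega,x)\in\Omega\times E$ and $v\in\mathbb{R}^d\setminus\{0\}$ let the finite-time Lyapunov exponent be $$\lambda_v(t,\omega,x)=\frac1t\ln\frac{\|\Phi(t,\omega,x)v\|}{\|v\|}\quad\text{for all } t\in(0,T^+(\omega,x)).$$ Then $$\lim_{t\to\infty}\ \sup_{x\in E}\ \operatorname*{ess\,sup}_{\{\omega\in\Omega:\,T^+(\omega,x)>t\}}\ \sup_{v\ne0}\lambda_v(t,\omega,x)=\sup\Sigma,$$ provided that $\sup\Sigma<\infty$, and $$\lim_{t\to\infty}\ \inf_{x\in E}\ \operatorname*{ess\,inf}_{\{\omega\in\Omega:\,T^+(\omega,x)>t\}}\ \inf_{v\ne0}\lambda_v(t,\omega,x)=\inf\Sigma,$$ provided that $\inf\Sigma>-\infty$.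
   Context: Setting: $E\subset\mathbb{R}^d$ is a bounded open set, $(\Omega,\mathcal F,\mathbb P)$ a probability space with a measurable measure-preserving flow $\theta:\mathbb{R}\times\Omega\to\Omega$, and $\varphi:D\subset\mathbb{R}\times\Omega\times E\to\mathbb{R}^d$ a (local) $C^1$ random dynamical system (cocycle) over $\theta$: $\varphi(0,\omega,x)=x$, $\varphi(t+s,\omega,x)=\varphi(t,\theta_s\omega,\varphi(s,\omega,x))$ where defined, $\varphi$ being $C^1$ in $x$. For all $x\in E$ and almost all $\omega$, $D_{\omega,x}=\{t:(t,\omega,x)\in D\}$ is an interval containing $0$ in its interior. $\Theta$ denotes the skew product $\Theta_t(\omega,x)=(\theta_t\omega,\varphi(t,\omega,x))$, and $\Phi(t,\omega,x)=\frac{\partial\varphi}{\partial x}(t,\omega,x)\in\mathbb{R}^{d\times d}$ is the linear cocycle over $\Theta$. Hitting times: $T^+(\omega,x)=\inf\{t>0:\varphi(t,\omega,x)\in\partial E\}$, $T^-(\omega,x)=\sup\{t<0:\varphi(t,\omega,x)\in\partial E\}$, with $(T^-(\omega,x),T^+(\omega,x))\subset D_{\omega,x}$. Assume that for all $x\in E$: $T^+(\cdot,x)<\infty$ and $T^-(\cdot,x)>-\infty$ almost surely, $\mathbb{P}(T^+(\cdot,x)>t)>0$ for all $t\ge0$, and $\mathbb{P}(T^-(\cdot,x)<t)>0$ for all $t\le0$. Boundedness assumption: for all $t^*>0$ there is $M>0$ such that for almost all $\omega$, $\|\Phi(t,\omega,x)\|\le M$ for all $x\in E$ and $t\in[\max\{-t^*,T^-(\omega,x)\},\min\{t^*,T^+(\omega,x)\}]$.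 Invariant projector: a measurable $P:\Omega\times E\to\mathbb{R}^{d\times d}$ such that for almost all $\omega$ and all $x\in E$: (i) $P(\omega,x)^2=P(\omega,x)$; (ii) $P(\Theta_t(\omega,x))\Phi(t,\omega,x)=\Phi(t,\omega,x)P(\omega,x)$ for all $T^-(\omega,x)<t<T^+(\omega,x)$; (iii) there is $r\in\{0,\dots,d\}$ with $\operatorname{rk}P(\omega,x)=r$ for almost all $\omega$ and all $x\in E$. Exponential dichotomy with growth rate $\gamma\in\mathbb{R}$: there are an invariant projector $P_\gamma$ and constants $\alpha>0$, $K\ge1$ such that for almost all $\omega$ and all $x\in E$, $\|\Phi(t,\omega,x)P_\gamma(\omega,x)\|\le Ke^{(\gamma-\alpha)t}$ for $0\le t<T^+(\omega,x)$ and $\|\Phi(t,\omega,x)(\mathrm{Id}-P_\gamma(\omega,x))\|\le Ke^{(\gamma+\alpha)t}$ for $0\ge t>T^-(\omega,x)$. The system admits an exponential dichotomy with growth rate $\infty$ (resp. $-\infty$) if for some $\gamma\in\mathbb{R}$ it admits one with growth rate $\gamma$ and projector $P_\gamma=\mathrm{Id}$ (resp. $P_\gamma=0$). Dichotomy spectrum: with $\overline{\mathbb{R}}=\mathbb{R}\cup\{-\infty,\infty\}$, $\Sigma=\{\gamma\in\overline{\mathbb{R}}:(\Theta,\Phi,T^+,T^-)\text{ does not admit an exponential dichotomy with growth rate }\gamma\}$. *)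

theory Defs
  imports "HOL-Probability.Probability"
begin

definition measure_preserving_flow :: "'w measure \<Rightarrow> (real \<Rightarrow> 'w \<Rightarrow> 'w) \<Rightarrow> bool" where
  "measure_preserving_flow M \<theta> \<longleftrightarrow>
     (\<lambda>(t, \<omega>). \<theta> t \<omega>) \<in> borel \<Otimes>\<^sub>M M \<rightarrow>\<^sub>M M \<and>
     (\<forall>\<omega>\<in>space M. \<theta> 0 \<omega> = \<omega>) \<and>
     (\<forall>s t. \<forall>\<omega>\<in>space M. \<theta> (t + s) \<omega> = \<theta> t (\<theta> s \<omega>)) \<and>
     (\<forall>t. distr M M (\<theta> t) = M)"

text \<open>
  The linear cocycle, with values in the \<open>d \<times> d\<close> matrices, \<open>d = CARD('n)\<close>.
  It is meaningful at the points of the domain of \<open>\<phi>\<close>.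
\<close>
definition lin_cocycle ::
  "(real \<Rightarrow> 'w \<Rightarrow> real^'n \<Rightarrow> real^'n) \<Rightarrow> real \<Rightarrow> 'w \<Rightarrow> real^'n \<Rightarrow> real^'n^'n" where
  "lin_cocycle \<phi> t \<omega> x = jacobian (\<phi> t \<omega>) (at x)"

text \<open>
  Local \<open>C\<^sup>1\<close> random dynamical systems, following Arnold: for each \<open>\<omega>\<close> the domain
  is open in time and space, and \<open>\<phi>\<close> is continuous in time and space and \<open>C\<^sup>1\<close> in
  space. The values of \<open>\<phi>\<close> outside \<open>D\<close> are irrelevant. Since \<open>D\<close> only has points with
  state in \<open>E\<close>, the right-hand side of the cocycle identity is defined only if
  \<open>\<phi> s \<omega> x \<in> E\<close>; the identity is required when both sides are defined.
\<close>
definition local_C1_rds ::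
  "'w measure \<Rightarrow> (real \<Rightarrow> 'w \<Rightarrow> 'w) \<Rightarrow> (real^'n) set \<Rightarrow> (real \<times> 'w \<times> (real^'n)) set
     \<Rightarrow> (real \<Rightarrow> 'w \<Rightarrow> real^'n \<Rightarrow> real^'n) \<Rightarrow> bool" where
  "local_C1_rds M \<theta> E D \<phi> \<longleftrightarrow>
     D \<subseteq> UNIV \<times> space M \<times> E \<and>
     D \<in> sets (borel \<Otimes>\<^sub>M M \<Otimes>\<^sub>M borel) \<and>
     (\<lambda>(t, \<omega>, x). \<phi> t \<omega> x) \<in> restrict_space (borel \<Otimes>\<^sub>M M \<Otimes>\<^sub>M borel) D \<rightarrow>\<^sub>M borel \<and>
     (\<forall>\<omega>\<in>space M. open {(t, x). (t, \<omega>, x) \<in> D}) \<and>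
     (\<forall>\<omega>\<in>space M. continuous_on {(t, x). (t, \<omega>, x) \<in> D} (\<lambda>(t, x). \<phi> t \<omega> x)) \<and>
     (\<forall>\<omega>\<in>space M. \<forall>t. (\<forall>x\<in>{x. (t, \<omega>, x) \<in> D}. \<phi> t \<omega> differentiable (at x)) \<and>
                        continuous_on {x. (t, \<omega>, x) \<in> D} (lin_cocycle \<phi> t \<omega>)) \<and>
     (\<forall>\<omega>\<in>space M. \<forall>x\<in>E. (0, \<omega>, x) \<in> D \<and> \<phi> 0 \<omega> x = x) \<and>
     (\<forall>s t \<omega> x. (s, \<omega>, x) \<in> D \<and> (t + s, \<omega>, x) \<in> D \<and> (t, \<theta> s \<omega>, \<phi> s \<omega> x) \<in> D \<longrightarrow>
        \<phi> (t + s) \<omega> x = \<phi> t (\<theta> s \<omega>) (\<phi> s \<omega> x))"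

definition skew_product ::
  "(real \<Rightarrow> 'w \<Rightarrow> 'w) \<Rightarrow> (real \<Rightarrow> 'w \<Rightarrow> real^'n \<Rightarrow> real^'n) \<Rightarrow> real \<Rightarrow> 'w \<times> (real^'n) \<Rightarrow> 'w \<times> (real^'n)" where
  "skew_product \<theta> \<phi> t = (\<lambda>(\<omega>, x). (\<theta> t \<omega>, \<phi> t \<omega> x))"

text \<open>Hitting times of the boundary; \<open>\<infinity>\<close> and \<open>-\<infinity>\<close> if the boundary is not hit.\<close>
definition T_plus ::
  "(real^'n) set \<Rightarrow> (real \<times> 'w \<times> (real^'n)) set \<Rightarrow> (real \<Rightarrow> 'w \<Rightarrow> real^'n \<Rightarrow> real^'n)
     \<Rightarrow> 'w \<Rightarrow> real^'n \<Rightarrow> ereal" where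
  "T_plus E D \<phi> \<omega> x = Inf (ereal ` {t. t > 0 \<and> (t, \<omega>, x) \<in> D \<and> \<phi> t \<omega> x \<in> frontier E})"

definition T_minus ::
  "(real^'n) set \<Rightarrow> (real \<times> 'w \<times> (real^'n)) set \<Rightarrow> (real \<Rightarrow> 'w \<Rightarrow> real^'n \<Rightarrow> real^'n)
     \<Rightarrow> 'w \<Rightarrow> real^'n \<Rightarrow> ereal" where
  "T_minus E D \<phi> \<omega> x = Sup (ereal ` {t. t < 0 \<and> (t, \<omega>, x) \<in> D \<and> \<phi> t \<omega> x \<in> frontier E})"

text \<open>
  The operator norm for the Euclidean norm; the library's \<open>norm\<close> on matrices is the
  Frobenius norm.
\<close>
definition mat_norm :: "real^'n^'n \<Rightarrow> real" where
  "mat_norm A = onorm (\<lambda>v. A *v v)"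

definition invariant_projector ::
  "'w measure \<Rightarrow> (real \<Rightarrow> 'w \<Rightarrow> 'w) \<Rightarrow> (real^'n) set \<Rightarrow> (real \<times> 'w \<times> (real^'n)) set
     \<Rightarrow> (real \<Rightarrow> 'w \<Rightarrow> real^'n \<Rightarrow> real^'n) \<Rightarrow> ('w \<times> (real^'n) \<Rightarrow> real^'n^'n) \<Rightarrow> bool" where
  "invariant_projector M \<theta> E D \<phi> P \<longleftrightarrow>
     P \<in> M \<Otimes>\<^sub>M restrict_space borel E \<rightarrow>\<^sub>M borel \<and>
     (AE \<omega> in M. \<forall>x\<in>E. P (\<omega>, x) ** P (\<omega>, x) = P (\<omega>, x)) \<and>
     (AE \<omega> in M. \<forall>x\<in>E. \<forall>t. T_minus E D \<phi> \<omega> x < ereal t \<and> ereal t < T_plus E D \<phi> \<omega> x \<longrightarrow>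
        P (skew_product \<theta> \<phi> t (\<omega>, x)) ** lin_cocycle \<phi> t \<omega> x = lin_cocycle \<phi> t \<omega> x ** P (\<omega>, x)) \<and>
     (\<exists>r\<in>{0..CARD('n)}. AE \<omega> in M. \<forall>x\<in>E. rank (P (\<omega>, x)) = r)"

definition dichotomy_with ::
  "'w measure \<Rightarrow> (real \<Rightarrow> 'w \<Rightarrow> 'w) \<Rightarrow> (real^'n) set \<Rightarrow> (real \<times> 'w \<times> (real^'n)) set
     \<Rightarrow> (real \<Rightarrow> 'w \<Rightarrow> real^'n \<Rightarrow> real^'n) \<Rightarrow> real \<Rightarrow> ('w \<times> (real^'n) \<Rightarrow> real^'n^'n) \<Rightarrow> bool" where
  "dichotomy_with M \<theta> E D \<phi> \<gamma> P \<longleftrightarrow>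
     invariant_projector M \<theta> E D \<phi> P \<and>
     (\<exists>\<alpha>>0. \<exists>K\<ge>1. AE \<omega> in M. \<forall>x\<in>E.
        (\<forall>t. 0 \<le> t \<and> ereal t < T_plus E D \<phi> \<omega> x \<longrightarrow>
           mat_norm (lin_cocycle \<phi> t \<omega> x ** P (\<omega>, x)) \<le> K * exp ((\<gamma> - \<alpha>) * t)) \<and>
        (\<forall>t. t \<le> 0 \<and> T_minus E D \<phi> \<omega> x < ereal t \<longrightarrow>
           mat_norm (lin_cocycle \<phi> t \<omega> x ** (mat 1 - P (\<omega>, x))) \<le> K * exp ((\<gamma> + \<alpha>) * t)))"

definition admits_dichotomy ::
  "'w measure \<Rightarrow> (real \<Rightarrow> 'w \<Rightarrow> 'w) \<Rightarrow> (real^'n) set \<Rightarrow> (real \<times> 'w \<times> (real^'n)) set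
     \<Rightarrow> (real \<Rightarrow> 'w \<Rightarrow> real^'n \<Rightarrow> real^'n) \<Rightarrow> ereal \<Rightarrow> bool" where
  "admits_dichotomy M \<theta> E D \<phi> \<gamma> \<longleftrightarrow>
     (case \<gamma> of
        ereal g \<Rightarrow> \<exists>P. dichotomy_with M \<theta> E D \<phi> g P
      | PInfty \<Rightarrow> \<exists>g. dichotomy_with M \<theta> E D \<phi> g (\<lambda>_. mat 1)
      | MInfty \<Rightarrow> \<exists>g. dichotomy_with M \<theta> E D \<phi> g (\<lambda>_. 0))"

definition dichotomy_spectrum ::
  "'w measure \<Rightarrow> (real \<Rightarrow> 'w \<Rightarrow> 'w) \<Rightarrow> (real^'n) set \<Rightarrow> (real \<times> 'w \<times> (real^'n)) set
     \<Rightarrow> (real \<Rightarrow> 'w \<Rightarrow> real^'n \<Rightarrow> real^'n) \<Rightarrow> ereal set" where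
  "dichotomy_spectrum M \<theta> E D \<phi> = {\<gamma>. \<not> admits_dichotomy M \<theta> E D \<phi> \<gamma>}"

definition ftle ::
  "(real \<Rightarrow> 'w \<Rightarrow> real^'n \<Rightarrow> real^'n) \<Rightarrow> real^'n \<Rightarrow> real \<Rightarrow> 'w \<Rightarrow> real^'n \<Rightarrow> real" where
  "ftle \<phi> v t \<omega> x = 1 / t * ln (norm (lin_cocycle \<phi> t \<omega> x *v v) / norm v)"

text \<open>
  Essential supremum and infimum over a subset \<open>A\<close> of the measure space. The library's
  \<open>esssup\<close> is \<open>\<infinity>\<close> by convention for functions that are not measurable, which already
  happens if a function is irregular on a null set only; the following does not depend on
  null sets and agrees with \<open>esssup\<close> on the restricted space in the measurable case.
\<close>
definition esssup_on :: "'w measure \<Rightarrow> 'w set \<Rightarrow> ('w \<Rightarrow> ereal) \<Rightarrow> ereal" where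
  "esssup_on M A f = Inf {c. AE \<omega> in M. \<omega> \<in> A \<longrightarrow> f \<omega> \<le> c}"

definition essinf_on :: "'w measure \<Rightarrow> 'w set \<Rightarrow> ('w \<Rightarrow> ereal) \<Rightarrow> ereal" where
  "essinf_on M A f = Sup {c. AE \<omega> in M. \<omega> \<in> A \<longrightarrow> c \<le> f \<omega>}"

end

theory Submission
  imports Defs
begin

text \<open>
  Let \<open>U\<close> be the set of the \<open>\<gamma>\<close> for which there is an exponential dichotomy with growth rate \<open>\<gamma>\<close> and
  projector \<open>Id\<close>. It is an open upper set, and it contains the limits of its elements that are
  growth rates of any dichotomy: the projector \<open>P\<close> of the latter must be \<open>Id\<close>, as vectors in the kernel
  of \<open>P\<close> would grow too fast along orbits that have been in \<open>E\<close> for a long time. Hence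
  \<open>sup \<Sigma> = inf U\<close> if \<open>sup \<Sigma> < \<infinity>\<close>. The dichotomy estimate for \<open>\<gamma> \<in> U\<close> bounds the finite-time
  exponents by \<open>\<gamma>\<close> for large times. Conversely, if the supremum of the finite-time exponents at a
  single time \<open>t\<close> is less than \<open>b\<close>, then \<open>\<parallel>\<Phi>(t, \<omega>, x)\<parallel> \<le> e\<^sup>b\<^sup>t\<close>, which is iterated by the cocycle property
  and, with the boundedness assumption on \<open>[0, t]\<close>, puts every \<open>c > b\<close> into \<open>U\<close>.
  The second limit is dual, with projector \<open>0\<close> and negative times.
\<close>

section \<open>Operator norm and idempotent matrices\<close>

lemma mat_norm_le_iff: "mat_norm A \<le> c \<longleftrightarrow> (\<forall>v. norm (A *v v) \<le> c * norm v)"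
  for A :: "real^'n^'n"
  unfolding mat_norm_def
  using onorm[OF matrix_vector_mul_bounded_linear, of A]
  by (meson mult_right_mono norm_ge_zero onorm_le order_trans)

lemma norm_matrix_vector_mult_le: "norm (A *v v) \<le> mat_norm A * norm v"
  for A :: "real^'n^'n"
  using mat_norm_le_iff by blast

lemma mat_norm_nonneg: "0 \<le> mat_norm A"
  unfolding mat_norm_def by (rule onorm_pos_le) simp

lemma mat_norm_mult: "mat_norm (A ** B) \<le> mat_norm A * mat_norm B"
  unfolding mat_norm_le_iff
proof
  fix v
  have "norm (A ** B *v v) \<le> mat_norm A * norm (B *v v)"
    by (metis norm_matrix_vector_mult_le matrix_vector_mul_assoc)
  also have "\<dots> \<le> mat_norm A * (mat_norm B * norm v)"
    by (intro mult_left_mono norm_matrix_vector_mult_le mat_norm_nonneg)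
  finally show "norm (A ** B *v v) \<le> mat_norm A * mat_norm B * norm v"
    by (simp add: mult.assoc)
qed

lemma mat_norm_mult_le: "mat_norm A \<le> a \<Longrightarrow> mat_norm B \<le> b \<Longrightarrow> mat_norm (A ** B) \<le> a * b"
  by (meson mat_norm_mult mat_norm_nonneg mult_mono order_trans)

lemma mat_norm_one: "mat_norm (mat 1) \<le> 1"
  by (simp add: mat_norm_le_iff)

lemma mat_norm_zero: "mat_norm 0 = 0"
  by (simp add: mat_norm_def onorm_zero)

lemma continuous_matrix_vector_mult_left: "continuous_on S (\<lambda>A::real^'n^'m. A *v v)"
  unfolding matrix_vector_mult_def
  by (intro continuous_on_vec_lambda continuous_intros)

text \<open>Full rank makes \<open>P\<close> injective, and an injective map can be cancelled from
  \<open>P (P v) = P v\<close>.\<close>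

lemma idempotent_full_rank_eq_one:
  fixes P :: "real^'n^'n"
  assumes "P ** P = P" "rank P = CARD('n)"
  shows "P = mat 1"
proof -
  have "inj ((*v) P)"
    using assms(2) full_rank_injective by blast
  then have "P *v v = v" for v
    by (metis assms(1) injD matrix_vector_mul_assoc)
  then show ?thesis
    by (simp add: matrix_eq)
qed

section \<open>Survival times and the linear cocycle\<close>

locale local_rds =
  fixes M :: "'w measure"
    and \<theta> :: "real \<Rightarrow> 'w \<Rightarrow> 'w"
    and E :: "(real^'n) set"
    and D :: "(real \<times> 'w \<times> (real^'n)) set"
    and \<phi> :: "real \<Rightarrow> 'w \<Rightarrow> real^'n \<Rightarrow> real^'n"
  assumes flow: "measure_preserving_flow M \<theta>"
    and open_E: "open E"
    and rds: "local_C1_rds M \<theta> E D \<phi>"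
    and domain: "AE \<omega> in M. \<forall>x\<in>E. \<forall>t. T_minus E D \<phi> \<omega> x < ereal t \<and> ereal t < T_plus E D \<phi> \<omega> x \<longrightarrow>
         (t, \<omega>, x) \<in> D"
begin

abbreviation "Tp \<equiv> T_plus E D \<phi>"
abbreviation "Tm \<equiv> T_minus E D \<phi>"
abbreviation "\<Phi> \<equiv> lin_cocycle \<phi>"

text \<open>One predicate serves both directions of time. For states in \<open>E\<close> the
  inequality on the far side of 0 is automatic, so the one-sided conditions of the dichotomy
  estimates are recovered by \<open>alive_iff_less_T_plus\<close> and
  \<open>alive_iff_T_minus_less\<close>.\<close>

definition alive :: "real \<Rightarrow> 'w \<Rightarrow> real^'n \<Rightarrow> bool" where
  "alive t \<omega> x \<longleftrightarrow> Tm \<omega> x < ereal t \<and> ereal t < Tp \<omega> x"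

text \<open>Packages the almost sure hypothesis \<open>domain\<close> as a property of a single
  \<omega>, so that it can be transported along the flow and required at \<omega> and at its shifts
  separately.\<close>

definition regular :: "'w \<Rightarrow> bool" where
  "regular \<omega> \<longleftrightarrow> \<omega> \<in> space M \<and> (\<forall>x\<in>E. \<forall>t. alive t \<omega> x \<longrightarrow> (t, \<omega>, x) \<in> D)"

section \<open>Almost sure statements along the flow\<close>

lemma AE_regular: "AE \<omega> in M. regular \<omega>"
  using domain AE_space by eventually_elim (auto simp: regular_def alive_def)

lemma measurable_flow: "\<theta> s \<in> M \<rightarrow>\<^sub>M M"
proof -
  have "(\<lambda>(t, \<omega>). \<theta> t \<omega>) \<circ> Pair s \<in> M \<rightarrow>\<^sub>M M"
    using flow unfolding measure_preserving_flow_def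
    by (intro measurable_comp[where N = "borel \<Otimes>\<^sub>M M"]) auto
  then show ?thesis by (simp add: o_def)
qed

text \<open>Measure preservation: the preimage of a null set under \<open>\<theta> s\<close> is
  null. This lets an estimate be applied at the endpoint of an orbit segment and, through countable
  intersections, at all multiples of a time step.\<close>

lemma AE_flow:
  assumes "AE \<omega> in M. P \<omega>"
  shows "AE \<omega> in M. P (\<theta> s \<omega>)"
proof -
  have "distr M M (\<theta> s) = M"
    using flow unfolding measure_preserving_flow_def by blast
  then have "AE \<omega> in distr M M (\<theta> s). P \<omega>"
    using assms by (simp only:)
  then show ?thesis
    by (rule AE_distrD[OF measurable_flow])
qed

lemma flow_space: "\<omega> \<in> space M \<Longrightarrow> \<theta> s \<omega> \<in> space M"
  by (rule measurable_space[OF measurable_flow])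

lemma flow_0:
  assumes "\<omega> \<in> space M"
  shows "\<theta> 0 \<omega> = \<omega>"
proof -
  have "\<forall>\<omega>\<in>space M. \<theta> 0 \<omega> = \<omega>"
    using flow unfolding measure_preserving_flow_def by (elim conjE)
  from this[rule_format, OF assms] show ?thesis .
qed

section \<open>Regularity of the local system\<close>

lemma domain_E: "(t, \<omega>, x) \<in> D \<Longrightarrow> x \<in> E"
proof -
  have "D \<subseteq> UNIV \<times> space M \<times> E"
    using rds unfolding local_C1_rds_def by (elim conjE)
  then show "(t, \<omega>, x) \<in> D \<Longrightarrow> x \<in> E"
    by blast
qed

lemma open_domain: "\<omega> \<in> space M \<Longrightarrow> open {(t, x). (t, \<omega>, x) \<in> D}"
proof -
  have "\<forall>\<omega>\<in>space M. open {(t, x). (t, \<omega>, x) \<in> D}"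
    using rds unfolding local_C1_rds_def by (elim conjE)
  then show "\<omega> \<in> space M \<Longrightarrow> open {(t, x). (t, \<omega>, x) \<in> D}"
    by (rule bspec)
qed

lemma continuous_on_domain:
  "\<omega> \<in> space M \<Longrightarrow> continuous_on {(t, x). (t, \<omega>, x) \<in> D} (\<lambda>(t, x). \<phi> t \<omega> x)"
proof -
  have "\<forall>\<omega>\<in>space M. continuous_on {(t, x). (t, \<omega>, x) \<in> D} (\<lambda>(t, x). \<phi> t \<omega> x)"
    using rds unfolding local_C1_rds_def by (elim conjE)
  then show "\<omega> \<in> space M \<Longrightarrow> continuous_on {(t, x). (t, \<omega>, x) \<in> D} (\<lambda>(t, x). \<phi> t \<omega> x)"
    by (rule bspec)
qed

lemma
  assumes "\<omega> \<in> space M" "x \<in> E"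
  shows domain_0: "(0, \<omega>, x) \<in> D"
    and phi_0: "\<phi> 0 \<omega> x = x"
proof -
  have "\<forall>\<omega>\<in>space M. \<forall>x\<in>E. (0, \<omega>, x) \<in> D \<and> \<phi> 0 \<omega> x = x"
    using rds unfolding local_C1_rds_def by (elim conjE)
  then show "(0, \<omega>, x) \<in> D" "\<phi> 0 \<omega> x = x"
    using assms by blast+
qed

lemma
  assumes "\<omega> \<in> space M"
  shows differentiable_phi: "(t, \<omega>, x) \<in> D \<Longrightarrow> \<phi> t \<omega> differentiable (at x)"
    and continuous_on_lin_cocycle: "continuous_on {x. (t, \<omega>, x) \<in> D} (\<Phi> t \<omega>)"
proof -
  have "\<forall>\<omega>\<in>space M. \<forall>t. (\<forall>x\<in>{x. (t, \<omega>, x) \<in> D}. \<phi> t \<omega> differentiable (at x)) \<and>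
                        continuous_on {x. (t, \<omega>, x) \<in> D} (\<Phi> t \<omega>)"
    using rds unfolding local_C1_rds_def by (elim conjE)
  then show "(t, \<omega>, x) \<in> D \<Longrightarrow> \<phi> t \<omega> differentiable (at x)"
    and "continuous_on {x. (t, \<omega>, x) \<in> D} (\<Phi> t \<omega>)"
    using assms by blast+
qed

lemma cocycle:
  assumes "(s, \<omega>, x) \<in> D" "(t + s, \<omega>, x) \<in> D" "(t, \<theta> s \<omega>, \<phi> s \<omega> x) \<in> D"
  shows "\<phi> (t + s) \<omega> x = \<phi> t (\<theta> s \<omega>) (\<phi> s \<omega> x)"
proof -
  have "\<forall>s t \<omega> x. (s, \<omega>, x) \<in> D \<and> (t + s, \<omega>, x) \<in> D \<and> (t, \<theta> s \<omega>, \<phi> s \<omega> x) \<in> D \<longrightarrow>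
        \<phi> (t + s) \<omega> x = \<phi> t (\<theta> s \<omega>) (\<phi> s \<omega> x)"
    using rds unfolding local_C1_rds_def by (elim conjE)
  from this[rule_format, OF conjI[OF assms(1) conjI[OF assms(2,3)]]] show ?thesis .
qed

lemma open_domain_space: "\<omega> \<in> space M \<Longrightarrow> open {x. (t, \<omega>, x) \<in> D}"
proof -
  assume "\<omega> \<in> space M"
  then have "open (Pair t -` {(t, x). (t, \<omega>, x) \<in> D})"
    by (intro open_vimage open_domain continuous_intros)
  then show ?thesis by (simp add: vimage_def)
qed

section \<open>Derivative in the state and the linear cocycle identity\<close>

lemma has_derivative_phi:
  assumes "\<omega> \<in> space M" "(t, \<omega>, x) \<in> D"
  shows "(\<phi> t \<omega> has_derivative (*v) (\<Phi> t \<omega> x)) (at x)"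
  using differentiable_phi[OF assms] unfolding lin_cocycle_def jacobian_works .

text \<open>The chain rule applied to the cocycle identity. Differentiating needs the identity in a
  neighbourhood of \<open>x\<close>, not only at \<open>x\<close>; openness of the domain provides
  it.\<close>

lemma lin_cocycle_add:
  assumes \<omega>: "\<omega> \<in> space M"
    and D: "(s, \<omega>, x) \<in> D" "(t + s, \<omega>, x) \<in> D" "(t, \<theta> s \<omega>, \<phi> s \<omega> x) \<in> D"
  shows "\<Phi> (t + s) \<omega> x = \<Phi> t (\<theta> s \<omega>) (\<phi> s \<omega> x) ** \<Phi> s \<omega> x"
proof -
  define S where "S = {y. (s, \<omega>, y) \<in> D}"
  \<comment> \<open>\<open>V\<close> consists of the states at which both sides of the cocycle
    identity are defined. It is open because the domains are open and
    \<open>\<phi> s \<omega>\<close> is continuous on \<open>S\<close>.\<close>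
  define V where "V = S \<inter> \<phi> s \<omega> -` {y. (t, \<theta> s \<omega>, y) \<in> D} \<inter> {y. (t + s, \<omega>, y) \<in> D}"
  have "continuous_on S (\<phi> s \<omega>)"
    using has_derivative_phi[OF \<omega>] unfolding S_def
    by (intro continuous_at_imp_continuous_on ballI has_derivative_continuous) auto
  then have V: "open V"
    unfolding V_def S_def
    by (intro open_Int continuous_open_preimage open_domain_space flow_space \<omega>)
  have x: "x \<in> V"
    using D by (simp add: V_def S_def)
  have deriv: "((\<lambda>y. \<phi> t (\<theta> s \<omega>) (\<phi> s \<omega> y)) has_derivative
      (\<lambda>v. \<Phi> t (\<theta> s \<omega>) (\<phi> s \<omega> x) *v (\<Phi> s \<omega> x *v v))) (at x)"
    by (rule has_derivative_compose[OF has_derivative_phi has_derivative_phi])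
      (use \<omega> D flow_space in auto)
  have "(\<phi> (t + s) \<omega> has_derivative
      (\<lambda>v. \<Phi> t (\<theta> s \<omega>) (\<phi> s \<omega> x) *v (\<Phi> s \<omega> x *v v))) (at x)"
  proof (rule has_derivative_transform_within_open[OF deriv V x])
    show "\<phi> t (\<theta> s \<omega>) (\<phi> s \<omega> y) = \<phi> (t + s) \<omega> y" if "y \<in> V" for y
      using that unfolding V_def S_def by (intro cocycle[symmetric]) simp_all
  qed
  from has_derivative_unique[OF this has_derivative_phi[OF \<omega> D(2)]]
  have "\<Phi> (t + s) \<omega> x *v v = (\<Phi> t (\<theta> s \<omega>) (\<phi> s \<omega> x) ** \<Phi> s \<omega> x) *v v" for v
    unfolding matrix_vector_mul_assoc[symmetric] by (rule fun_cong[symmetric])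
  then show ?thesis
    unfolding matrix_eq by blast
qed

lemma lin_cocycle_0:
  assumes "\<omega> \<in> space M" "x \<in> E"
  shows "\<Phi> 0 \<omega> x = mat 1"
proof -
  have "((\<lambda>y. y) has_derivative (\<lambda>v. v)) (at x)"
    by (rule has_derivative_ident)
  then have "(\<phi> 0 \<omega> has_derivative (\<lambda>v. v)) (at x)"
    by (rule has_derivative_transform_within_open[OF _ open_E]) (auto simp: assms phi_0)
  from has_derivative_unique[OF this has_derivative_phi[OF assms(1) domain_0[OF assms]]]
  have "\<Phi> 0 \<omega> x *v v = v" for v
    by (rule fun_cong[symmetric])
  then show ?thesis
    by (simp add: matrix_eq)
qed

section \<open>Hitting times, survival and restarted orbits\<close>

lemma le_T_plus_iff:
  "ereal c \<le> Tp \<omega> x \<longleftrightarrow> (\<forall>u>0. u < c \<longrightarrow> (u, \<omega>, x) \<in> D \<longrightarrow> \<phi> u \<omega> x \<notin> frontier E)"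
  unfolding T_plus_def le_Inf_iff by (force simp: not_le)

lemma T_minus_le_iff:
  "Tm \<omega> x \<le> ereal c \<longleftrightarrow> (\<forall>u<0. c < u \<longrightarrow> (u, \<omega>, x) \<in> D \<longrightarrow> \<phi> u \<omega> x \<notin> frontier E)"
  unfolding T_minus_def Sup_le_iff by (force simp: not_le)

lemma open_inside: "\<omega> \<in> space M \<Longrightarrow> open {(t, x). (t, \<omega>, x) \<in> D \<and> \<phi> t \<omega> x \<in> E}"
proof -
  assume "\<omega> \<in> space M"
  then have "open ({(t, x). (t, \<omega>, x) \<in> D} \<inter> (\<lambda>(t, x). \<phi> t \<omega> x) -` E)"
    by (intro continuous_open_preimage continuous_on_domain open_domain open_E)
  moreover have "\<dots> = {(t, x). (t, \<omega>, x) \<in> D \<and> \<phi> t \<omega> x \<in> E}"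
    by auto
  ultimately show ?thesis by simp
qed

lemma E_not_frontier: "y \<in> E \<Longrightarrow> y \<notin> frontier E"
  using open_E by (simp add: frontier_def interior_open)

text \<open>The times at which the orbit is defined and inside \<open>E\<close> form an open set
  containing 0, and the open set \<open>E\<close> misses its frontier. Hence both hitting times keep
  a positive distance \<open>e\<close> from 0.\<close>

lemma alive_0:
  assumes "\<omega> \<in> space M" "x \<in> E"
  shows "alive 0 \<omega> x"
proof -
  let ?W = "{t. (t, \<omega>, x) \<in> D \<and> \<phi> t \<omega> x \<in> E}"
  have "open ((\<lambda>t. (t, x)) -` {(t, x). (t, \<omega>, x) \<in> D \<and> \<phi> t \<omega> x \<in> E})"
    by (intro open_vimage open_inside continuous_intros assms)
  then have "open ?W"
    by (simp add: vimage_def)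
  moreover have "0 \<in> ?W"
    using assms by (simp add: domain_0 phi_0)
  ultimately obtain e where e: "e > 0" "ball 0 e \<subseteq> ?W"
    using open_contains_ball by blast
  then have "\<phi> u \<omega> x \<notin> frontier E" if "\<bar>u\<bar> < e" for u
    using that by (intro E_not_frontier) (auto simp: subset_iff)
  then have "ereal e \<le> Tp \<omega> x" "Tm \<omega> x \<le> ereal (-e)"
    unfolding le_T_plus_iff T_minus_le_iff by auto
  moreover have "ereal (-e) < ereal 0" "ereal 0 < ereal e"
    using e by auto
  ultimately show ?thesis
    unfolding alive_def by (meson less_le_trans le_less_trans)
qed

lemma alive_between: "alive a \<omega> x \<Longrightarrow> alive b \<omega> x \<Longrightarrow> a \<le> s \<Longrightarrow> s \<le> b \<Longrightarrow> alive s \<omega> x"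
  unfolding alive_def by (meson ereal_less_eq(3) le_less_trans less_le_trans)

lemma alive_iff_less_T_plus:
  "\<omega> \<in> space M \<Longrightarrow> x \<in> E \<Longrightarrow> 0 \<le> t \<Longrightarrow> alive t \<omega> x \<longleftrightarrow> ereal t < Tp \<omega> x"
  using alive_0[of \<omega> x] unfolding alive_def by (meson ereal_less_eq(3) less_le_trans)

lemma alive_iff_T_minus_less:
  "\<omega> \<in> space M \<Longrightarrow> x \<in> E \<Longrightarrow> t \<le> 0 \<Longrightarrow> alive t \<omega> x \<longleftrightarrow> Tm \<omega> x < ereal t"
  using alive_0[of \<omega> x] unfolding alive_def by (meson ereal_less_eq(3) le_less_trans)

text \<open>An orbit segment is connected, so leaving \<open>E\<close> would mean crossing the
  frontier at some time between 0 and \<open>t\<close>, which contradicts the definition of one of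
  the two hitting times.\<close>

lemma alive_in_E:
  assumes "regular \<omega>" "x \<in> E" "alive t \<omega> x"
  shows "\<phi> t \<omega> x \<in> E"
proof (rule ccontr)
  assume no: "\<phi> t \<omega> x \<notin> E"
  have \<omega>: "\<omega> \<in> space M"
    using assms by (simp add: regular_def)
  let ?I = "closed_segment 0 t"
  have al: "alive u \<omega> x" if "u \<in> ?I" for u
    using that alive_0[OF \<omega> assms(2)] assms(3) alive_between[of 0 \<omega> x t u] alive_between[of t \<omega> x 0 u]
    by (auto simp: closed_segment_eq_real_ivl split: if_splits)
  have "continuous_on ?I ((\<lambda>(t, x). \<phi> t \<omega> x) \<circ> (\<lambda>u. (u, x)))"
    using al assms
    by (intro continuous_on_compose continuous_intros continuous_on_subset[OF continuous_on_domain[OF \<omega>]])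
      (auto simp: regular_def)
  then have "connected ((\<lambda>u. \<phi> u \<omega> x) ` ?I)"
    by (intro connected_continuous_image) (auto simp: o_def)
  moreover have "x \<in> (\<lambda>u. \<phi> u \<omega> x) ` ?I"
    using phi_0[OF \<omega> assms(2)] by force
  ultimately have "(\<lambda>u. \<phi> u \<omega> x) ` ?I \<inter> frontier E \<noteq> {}"
    using no assms(2) by (intro connected_Int_frontier) auto
  then obtain u where u: "u \<in> ?I" "\<phi> u \<omega> x \<in> frontier E"
    by auto
  with al have au: "alive u \<omega> x" "(u, \<omega>, x) \<in> D"
    using assms by (auto simp: regular_def)
  \<comment> \<open>The hitting times only see nonzero times. A crossing at time 0 is excluded
    because the orbit starts at \<open>x\<close> in the open set \<open>E\<close>.\<close>
  then have "u \<noteq> 0"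
    using u \<omega> assms(2) by (auto simp: phi_0 E_not_frontier)
  moreover have False if "0 < u"
  proof -
    have "Tp \<omega> x \<le> ereal u"
      unfolding T_plus_def using that u au by (intro Inf_lower) auto
    then show False
      using au(1) by (auto simp: alive_def dest: leD)
  qed
  moreover have False if "u < 0"
  proof -
    have "ereal u \<le> Tm \<omega> x"
      unfolding T_minus_def using that u au by (intro Sup_upper) auto
    then show False
      using au(1) by (auto simp: alive_def dest: leD)
  qed
  ultimately show False
    by linarith
qed

text \<open>By the cocycle identity, the restarted orbit at time \<open>u\<close> is at the point
  that the original orbit reaches at time \<open>u + s\<close>. As long as the latter survives, this
  point lies in \<open>E\<close>, hence off the frontier.\<close>

lemma alive_shiftI:
  assumes reg: "regular \<omega>" and x: "x \<in> E" and s: "alive s \<omega> x" and ts: "alive (t + s) \<omega> x"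
  shows "alive t (\<theta> s \<omega>) (\<phi> s \<omega> x)"
proof -
  have \<omega>: "\<omega> \<in> space M"
    using reg by (simp add: regular_def)
  have Ds: "(s, \<omega>, x) \<in> D"
    using reg x s by (simp add: regular_def)
  have y: "\<phi> s \<omega> x \<in> E"
    by (rule alive_in_E[OF reg x s])
  have inside: "\<phi> u (\<theta> s \<omega>) (\<phi> s \<omega> x) \<notin> frontier E"
    if "alive (u + s) \<omega> x" "(u, \<theta> s \<omega>, \<phi> s \<omega> x) \<in> D" for u
    using that cocycle[OF Ds _ that(2)] alive_in_E[OF reg x] reg x E_not_frontier
    by (metis regular_def)
  have s': "Tm \<omega> x < ereal s" "ereal s < Tp \<omega> x" and ts': "Tm \<omega> x < ereal (t + s)" "ereal (t + s) < Tp \<omega> x"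
    using s ts by (auto simp: alive_def)
  \<comment> \<open>\<open>le_T_plus_iff\<close> yields only a weak bound on the hitting time. The
    number \<open>c\<close> strictly between \<open>t + s\<close> and the original hitting time
    makes the conclusion strict; the second \<open>c\<close> below does the same for negative
    times.\<close>
  from ereal_dense2[OF ts'(2)] obtain c where c: "ereal (t + s) < ereal c" "ereal c < Tp \<omega> x"
    by auto
  have "ereal (c - s) \<le> Tp (\<theta> s \<omega>) (\<phi> s \<omega> x)"
    unfolding le_T_plus_iff
  proof (intro allI impI)
    fix u assume u: "0 < u" "u < c - s" "(u, \<theta> s \<omega>, \<phi> s \<omega> x) \<in> D"
    have "alive (u + s) \<omega> x"
      using u s' c unfolding alive_def
      by (meson ereal_less_eq(3) le_less_trans less_le_trans less_add_same_cancel2 less_diff_eq less_imp_le)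
    then show "\<phi> u (\<theta> s \<omega>) (\<phi> s \<omega> x) \<notin> frontier E"
      using inside u by blast
  qed
  moreover have "ereal t < ereal (c - s)"
    using c by auto
  ultimately have 1: "ereal t < Tp (\<theta> s \<omega>) (\<phi> s \<omega> x)"
    by (rule less_le_trans[rotated])
  from ereal_dense2[OF ts'(1)] obtain c where c: "Tm \<omega> x < ereal c" "ereal c < ereal (t + s)"
    by auto
  have "Tm (\<theta> s \<omega>) (\<phi> s \<omega> x) \<le> ereal (c - s)"
    unfolding T_minus_le_iff
  proof (intro allI impI)
    fix u assume u: "u < 0" "c - s < u" "(u, \<theta> s \<omega>, \<phi> s \<omega> x) \<in> D"
    have "ereal (u + s) < ereal s" "ereal c < ereal (u + s)"
      using u by auto
    then have "alive (u + s) \<omega> x"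
      using s' c unfolding alive_def by (meson less_trans)
    then show "\<phi> u (\<theta> s \<omega>) (\<phi> s \<omega> x) \<notin> frontier E"
      using inside u by blast
  qed
  moreover have "ereal (c - s) < ereal t"
    using c by auto
  ultimately have 2: "Tm (\<theta> s \<omega>) (\<phi> s \<omega> x) < ereal t"
    by (rule le_less_trans)
  show ?thesis
    using 1 2 by (simp add: alive_def)
qed

text \<open>At the end of the segment of length \<open>s\<close> the time \<open>-s\<close> leads
  back to the starting time 0, where the linear cocycle is the identity. This gives the inverse of
  \<open>\<Phi> s \<omega> x\<close>, used for all changes of time direction.\<close>

lemma
  assumes reg: "regular \<omega>" "regular (\<theta> s \<omega>)" and x: "x \<in> E" and s: "alive s \<omega> x"
  shows alive_inverse: "alive (- s) (\<theta> s \<omega>) (\<phi> s \<omega> x)"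
    and lin_cocycle_inverse: "\<Phi> (- s) (\<theta> s \<omega>) (\<phi> s \<omega> x) ** \<Phi> s \<omega> x = mat 1"
proof -
  have \<omega>: "\<omega> \<in> space M"
    using reg by (simp add: regular_def)
  show *: "alive (- s) (\<theta> s \<omega>) (\<phi> s \<omega> x)"
    using alive_0[OF \<omega> x] by (intro alive_shiftI reg x s) simp
  have D: "(s, \<omega>, x) \<in> D" "(-s + s, \<omega>, x) \<in> D" "(-s, \<theta> s \<omega>, \<phi> s \<omega> x) \<in> D"
    using reg x s * alive_in_E[OF reg(1) x s] domain_0[OF \<omega> x] by (auto simp: regular_def)
  show "\<Phi> (- s) (\<theta> s \<omega>) (\<phi> s \<omega> x) ** \<Phi> s \<omega> x = mat 1"
    using lin_cocycle_add[OF \<omega> D] \<omega> x by (simp add: lin_cocycle_0)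
qed

lemma lin_cocycle_split:
  assumes "regular \<omega>" "regular (\<theta> s \<omega>)" "x \<in> E" "alive s \<omega> x" "alive (t + s) \<omega> x"
  shows "\<Phi> (t + s) \<omega> x = \<Phi> t (\<theta> s \<omega>) (\<phi> s \<omega> x) ** \<Phi> s \<omega> x"
proof (rule lin_cocycle_add)
  show "\<omega> \<in> space M" "(s, \<omega>, x) \<in> D" "(t + s, \<omega>, x) \<in> D"
    using assms unfolding regular_def by blast+
  show "(t, \<theta> s \<omega>, \<phi> s \<omega> x) \<in> D"
    using assms(2) alive_shiftI[OF assms(1,3,4,5)] alive_in_E[OF assms(1,3,4)]
    unfolding regular_def by blast
qed

text \<open>
  The hypothesis has an exceptional null set for each \<open>x\<close>, whereas a dichotomy needs a common one.
  Surviving up to time \<open>t\<close> is an open condition on \<open>x\<close>, so the points of a countable dense set suffice.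
\<close>
lemma AE_forall_of_forall_AE:
  fixes C :: "(real^'n^'n) set"
  assumes "closed C" "0 < t"
    and AE: "\<forall>x\<in>E. AE \<omega> in M. alive t \<omega> x \<longrightarrow> \<Phi> t \<omega> x \<in> C"
  shows "AE \<omega> in M. \<forall>x\<in>E. alive t \<omega> x \<longrightarrow> \<Phi> t \<omega> x \<in> C"
proof -
  obtain Q :: "(real^'n) set" where Q: "countable Q" "\<And>X. open X \<Longrightarrow> X \<noteq> {} \<Longrightarrow> \<exists>q\<in>Q. q \<in> X"
    using countable_dense_setE by blast
  have "AE \<omega> in M. \<forall>q\<in>Q \<inter> E. alive t \<omega> q \<longrightarrow> \<Phi> t \<omega> q \<in> C"
    using AE Q by (subst AE_ball_countable) auto
  with AE_regular show ?thesis
  proof eventually_elim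
    case (elim \<omega>)
    then have \<omega>: "\<omega> \<in> space M"
      by (simp add: regular_def)
    show ?case
    proof (intro ballI impI, rule ccontr)
      fix x assume x: "x \<in> E" "alive t \<omega> x" and no: "\<Phi> t \<omega> x \<notin> C"
      \<comment> \<open>The margin \<open>c > t\<close> is needed so that neighbouring states
        survive strictly beyond \<open>t\<close>.\<close>
      obtain c where c: "ereal t < ereal c" "ereal c < Tp \<omega> x"
        using ereal_dense2[of "ereal t" "Tp \<omega> x"] x by (auto simp: alive_def)
      then have alc: "alive c \<omega> x"
        using x \<open>0 < t\<close> \<omega> by (subst alive_iff_less_T_plus) auto
      let ?W = "{(x, t). (t, \<omega>, x) \<in> D \<and> \<phi> t \<omega> x \<in> E}"
      have "open (prod.swap -` {(t, x). (t, \<omega>, x) \<in> D \<and> \<phi> t \<omega> x \<in> E})"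
        by (intro open_vimage open_inside continuous_on_swap \<omega>)
      moreover have "\<dots> = ?W" by auto
      ultimately have "open ?W" by simp
      moreover have "alive u \<omega> x" if "u \<in> {0..c}" for u
        using that alive_between[OF alive_0[OF \<omega> x(1)] alc] by auto
      then have "{x} \<times> {0..c} \<subseteq> ?W"
        using elim(1) x(1) alive_in_E by (auto simp: regular_def)
      \<comment> \<open>The tube lemma on the compact interval \<open>{0..c}\<close>: all states in
        \<open>X\<close> have their orbits defined and inside \<open>E\<close> during the whole
        interval.\<close>
      ultimately obtain X where X: "x \<in> X" "open X" "X \<times> {0..c} \<subseteq> ?W"
        using Elementary_Topology.tube_lemma[of "{0..c}" ?W x] by auto
      have al: "alive t \<omega> y" "(t, \<omega>, y) \<in> D" "y \<in> E" if "y \<in> X" for y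
      proof -
        show "(t, \<omega>, y) \<in> D"
          using subsetD[OF X(3), of "(y, t)"] that c \<open>0 < t\<close> by simp
        then show "y \<in> E"
          by (rule domain_E)
        have "ereal c \<le> Tp \<omega> y"
          unfolding le_T_plus_iff
        proof (intro allI impI)
          fix u assume "0 < u" "u < c"
          then show "\<phi> u \<omega> y \<notin> frontier E"
            using subsetD[OF X(3), of "(y, u)"] that E_not_frontier by simp
        qed
        then have "ereal t < Tp \<omega> y"
          using c(1) by (rule less_le_trans[rotated])
        then show "alive t \<omega> y"
          using \<open>0 < t\<close> \<omega> \<open>y \<in> E\<close> by (subst alive_iff_less_T_plus) auto
      qed
      have "continuous_on X (\<Phi> t \<omega>)"
        using al by (intro continuous_on_subset[OF continuous_on_lin_cocycle[OF \<omega>]]) auto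
      \<comment> \<open>Since \<open>C\<close> is closed and the linear cocycle is continuous in the
        state, the failure at \<open>x\<close> persists on an open set and so occurs at a point of
        the dense set \<open>Q\<close>.\<close>
      then have "open (X \<inter> \<Phi> t \<omega> -` (- C))"
        using X \<open>closed C\<close> by (intro continuous_open_preimage) auto
      moreover have "x \<in> X \<inter> \<Phi> t \<omega> -` (- C)"
        using X no by auto
      ultimately obtain q where "q \<in> Q" "q \<in> X" "\<Phi> t \<omega> q \<notin> C"
        using Q(2)[of "X \<inter> \<Phi> t \<omega> -` (- C)"] by auto
      then show False
        using elim(2) al by auto
    qed
  qed
qed

end

section \<open>One-sided growth bounds\<close>

context local_rds
begin

lemma alive_multiple_le:
  assumes "\<omega> \<in> space M" "x \<in> E" "0 \<le> a" "a \<le> b" "alive (b * h) \<omega> x"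
  shows "alive (a * h) \<omega> x"
proof (cases "0 \<le> h")
  case True
  then show ?thesis
    using assms mult_right_mono[OF assms(4), of h]
    by (intro alive_between[OF alive_0[OF assms(1,2)] assms(5)]) auto
next
  case False
  then show ?thesis
    using assms mult_right_mono_neg[OF assms(4), of h]
    by (intro alive_between[OF assms(5) alive_0[OF assms(1,2)]]) (auto simp: mult_nonneg_nonpos)
qed

text \<open>Submultiplicativity along the orbit. The last step starts at time \<open>n * h\<close>,
  so the one-step bound has to be available over every shift
  \<open>\<theta> (real k * h) \<omega>\<close>. The step \<open>h\<close> may be negative.\<close>

lemma mat_norm_lin_cocycle_multiple:
  fixes q :: real
  assumes reg: "\<And>k. regular (\<theta> (real k * h) \<omega>)"
    and step: "\<And>k x. x \<in> E \<Longrightarrow> alive h (\<theta> (real k * h) \<omega>) x \<Longrightarrow>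
      mat_norm (\<Phi> h (\<theta> (real k * h) \<omega>) x) \<le> q"
    and \<omega>: "\<omega> \<in> space M" and x: "x \<in> E"
  shows "alive (real n * h) \<omega> x \<Longrightarrow> mat_norm (\<Phi> (real n * h) \<omega> x) \<le> q ^ n"
proof (induction n)
  case 0
  show ?case
    using \<omega> x by (simp add: lin_cocycle_0 mat_norm_one)
next
  case (Suc n)
  have reg0: "regular \<omega>"
    using reg[of 0] \<omega> by (simp add: flow_0)
  have split: "real (Suc n) * h = h + real n * h"
    by (simp add: algebra_simps)
  have s: "alive (real n * h) \<omega> x"
    using Suc.prems by (rule alive_multiple_le[OF \<omega> x, rotated 2]) auto
  have hs: "alive (h + real n * h) \<omega> x"
    using Suc.prems unfolding split .
  have "mat_norm (\<Phi> h (\<theta> (real n * h) \<omega>) (\<phi> (real n * h) \<omega> x)) \<le> q"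
    by (intro step alive_in_E[OF reg0 x s] alive_shiftI[OF reg0 x s hs])
  then show ?case
    unfolding split lin_cocycle_split[OF reg0 reg x s hs] power_Suc
    by (intro mat_norm_mult_le Suc.IH s)
qed

text \<open>
  The sign \<open>\<sigma> = \<plusminus>1\<close> selects the direction of time: \<open>\<sigma> = 1\<close> is a dichotomy with projector
  \<open>Id\<close>, and \<open>\<sigma> = -1\<close> one with projector \<open>0\<close>.
\<close>
definition growth_bound :: "real \<Rightarrow> real \<Rightarrow> bool" where
  "growth_bound \<sigma> \<gamma> \<longleftrightarrow> (\<exists>\<alpha>>0. \<exists>K\<ge>1. AE \<omega> in M. \<forall>x\<in>E. \<forall>t. alive t \<omega> x \<and> 0 \<le> \<sigma> * t \<longrightarrow>
     mat_norm (\<Phi> t \<omega> x) \<le> K * exp ((\<gamma> - \<sigma> * \<alpha>) * t))"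

lemma growth_boundI:
  assumes "\<alpha> > 0" "K \<ge> 1" "c = \<gamma> - \<sigma> * \<alpha>"
    and "AE \<omega> in M. \<forall>x\<in>E. \<forall>t. alive t \<omega> x \<and> 0 \<le> \<sigma> * t \<longrightarrow>
      mat_norm (\<Phi> t \<omega> x) \<le> K * exp (c * t)"
  shows "growth_bound \<sigma> \<gamma>"
  using assms unfolding growth_bound_def by blast

text \<open>For times of sign \<sigma>, moving \<gamma> in the direction \<sigma> can only enlarge
  the exponential; \<alpha> and \<open>K\<close> are kept.\<close>

lemma growth_bound_mono:
  assumes "growth_bound \<sigma> \<gamma>" "\<sigma> = 1 \<or> \<sigma> = - 1" "\<sigma> * \<gamma> \<le> \<sigma> * \<gamma>'"
  shows "growth_bound \<sigma> \<gamma>'"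
proof -
  from assms(1) obtain \<alpha> K where \<alpha>: "\<alpha> > 0" "K \<ge> 1"
    and AE: "AE \<omega> in M. \<forall>x\<in>E. \<forall>t. alive t \<omega> x \<and> 0 \<le> \<sigma> * t \<longrightarrow>
      mat_norm (\<Phi> t \<omega> x) \<le> K * exp ((\<gamma> - \<sigma> * \<alpha>) * t)"
    unfolding growth_bound_def by auto
  have "K * exp ((\<gamma> - \<sigma> * \<alpha>) * t) \<le> K * exp ((\<gamma>' - \<sigma> * \<alpha>) * t)" if "0 \<le> \<sigma> * t" for t
  proof -
    have "0 \<le> (\<sigma> * \<gamma>' - \<sigma> * \<gamma>) * (\<sigma> * t)"
      using assms(3) that by simp
    also have "\<dots> = (\<gamma>' - \<sigma> * \<alpha>) * t - (\<gamma> - \<sigma> * \<alpha>) * t"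
      using assms(2) by (auto simp: algebra_simps)
    finally show ?thesis
      using \<alpha> by simp
  qed
  note le = this
  have "AE \<omega> in M. \<forall>x\<in>E. \<forall>t. alive t \<omega> x \<and> 0 \<le> \<sigma> * t \<longrightarrow>
      mat_norm (\<Phi> t \<omega> x) \<le> K * exp ((\<gamma>' - \<sigma> * \<alpha>) * t)"
    using AE by eventually_elim (meson le order_trans)
  then show ?thesis
    by (rule growth_boundI[OF \<alpha> refl])
qed

text \<open>Half of the gap \<alpha> goes into the shift of \<gamma>, and the other half remains as
  the new gap.\<close>

lemma growth_bound_open:
  assumes "growth_bound \<sigma> \<gamma>"
  obtains \<delta> where "\<delta> > 0" "growth_bound \<sigma> (\<gamma> - \<sigma> * \<delta>)"
proof -
  from assms obtain \<alpha> K where \<alpha>: "\<alpha> > 0" "K \<ge> 1"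
    and AE: "AE \<omega> in M. \<forall>x\<in>E. \<forall>t. alive t \<omega> x \<and> 0 \<le> \<sigma> * t \<longrightarrow>
      mat_norm (\<Phi> t \<omega> x) \<le> K * exp ((\<gamma> - \<sigma> * \<alpha>) * t)"
    unfolding growth_bound_def by auto
  have "growth_bound \<sigma> (\<gamma> - \<sigma> * (\<alpha> / 2))"
    by (rule growth_boundI[OF _ \<alpha>(2) _ AE, of "\<alpha> / 2"]) (use \<alpha> in \<open>simp_all add: field_simps\<close>)
  with that[of "\<alpha> / 2"] \<alpha> show ?thesis
    by simp
qed

end

text \<open>Survival up to any time with positive probability supplies the long orbits that
  determine the rank of a projector. The uniform bound over bounded times controls the remainder
  between multiples of a fixed time step.\<close>

locale hitting_rds = local_rds M \<theta> E D \<phi>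
  for M :: "'w measure"
    and \<theta> :: "real \<Rightarrow> 'w \<Rightarrow> 'w"
    and E :: "(real^'n) set"
    and D :: "(real \<times> 'w \<times> (real^'n)) set"
    and \<phi> :: "real \<Rightarrow> 'w \<Rightarrow> real^'n \<Rightarrow> real^'n" +
  assumes T_plus_unbounded:
      "\<forall>x\<in>E. \<forall>t\<ge>0. measure M {\<omega>\<in>space M. Tp \<omega> x > ereal t} > 0"
    and T_minus_unbounded:
      "\<forall>x\<in>E. \<forall>t\<le>0. measure M {\<omega>\<in>space M. Tm \<omega> x < ereal t} > 0"
    and boundedness:
      "\<forall>ts>0. \<exists>B>0. AE \<omega> in M. \<forall>x\<in>E. \<forall>t.
         (t, \<omega>, x) \<in> D \<and>
         max (ereal (- ts)) (Tm \<omega> x) \<le> ereal t \<and>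
         ereal t \<le> min (ereal ts) (Tp \<omega> x) \<longrightarrow>
         mat_norm (\<Phi> t \<omega> x) \<le> B"
begin

lemma bounded_time_bound:
  assumes "h > 0"
  obtains B where "B > 0"
    "AE \<omega> in M. \<forall>x\<in>E. \<forall>t. alive t \<omega> x \<and> \<bar>t\<bar> \<le> h \<longrightarrow> mat_norm (\<Phi> t \<omega> x) \<le> B"
proof -
  from boundedness[rule_format, OF assms] obtain B where "B > 0" and
    B: "AE \<omega> in M. \<forall>x\<in>E. \<forall>t.
         (t, \<omega>, x) \<in> D \<and>
         max (ereal (- h)) (Tm \<omega> x) \<le> ereal t \<and>
         ereal t \<le> min (ereal h) (Tp \<omega> x) \<longrightarrow>
         mat_norm (\<Phi> t \<omega> x) \<le> B"
    by auto
  have "AE \<omega> in M. \<forall>x\<in>E. \<forall>t. alive t \<omega> x \<and> \<bar>t\<bar> \<le> h \<longrightarrow> mat_norm (\<Phi> t \<omega> x) \<le> B"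
    using B AE_regular
  proof eventually_elim
    case (elim \<omega>)
    show ?case
    proof (intro ballI allI impI)
      fix x t assume "x \<in> E" and t: "alive t \<omega> x \<and> \<bar>t\<bar> \<le> h"
      then have "(t, \<omega>, x) \<in> D"
        using elim(2) by (simp add: regular_def)
      moreover have "- h \<le> t" "t \<le> h"
        using t by auto
      ultimately show "mat_norm (\<Phi> t \<omega> x) \<le> B"
        using elim(1) \<open>x \<in> E\<close> t by (simp add: alive_def less_imp_le)
    qed
  qed
  with that \<open>B > 0\<close> show ?thesis
    by blast
qed

text \<open>Write \<open>t\<close> as \<open>n\<close> full steps \<open>h\<close> plus a remainder
  \<open>r\<close> no longer than a step. The steps give the exponential rate \<beta>, the remainder
  a constant factor, and the distance from \<beta> to \<gamma> is the gap.\<close>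

lemma growth_bound_of_step:
  assumes h: "0 < \<sigma> * h" and \<sigma>: "\<sigma> = 1 \<or> \<sigma> = - 1" and \<gamma>: "\<sigma> * \<beta> < \<sigma> * \<gamma>"
    and step: "AE \<omega> in M. \<forall>x\<in>E. alive h \<omega> x \<longrightarrow> mat_norm (\<Phi> h \<omega> x) \<le> exp (\<beta> * h)"
  shows "growth_bound \<sigma> \<gamma>"
proof -
  have "\<bar>h\<bar> > 0" "h \<noteq> 0"
    using h by auto
  from bounded_time_bound[OF this(1)] obtain B where B: "B > 0"
    "AE \<omega> in M. \<forall>x\<in>E. \<forall>t. alive t \<omega> x \<and> \<bar>t\<bar> \<le> \<bar>h\<bar> \<longrightarrow> mat_norm (\<Phi> t \<omega> x) \<le> B"
    by blast
  \<comment> \<open>\<open>B\<close> bounds the remainder, the exponential pays for replacing the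
    time \<open>n * h\<close> by \<open>t\<close>, and the maximum secures
    \<open>K \<ge> 1\<close>.\<close>
  define K where "K = max 1 (B * exp (\<bar>\<beta> * h\<bar>))"
  \<comment> \<open>Only the countably many shifts by multiples of \<open>h\<close> occur, so one
    null set can be discarded for all of them.\<close>
  have "AE \<omega> in M. \<forall>k. regular (\<theta> (real k * h) \<omega>)"
    unfolding AE_all_countable by (intro allI AE_flow AE_regular)
  moreover have "AE \<omega> in M. \<forall>k. \<forall>x\<in>E. alive h (\<theta> (real k * h) \<omega>) x \<longrightarrow>
      mat_norm (\<Phi> h (\<theta> (real k * h) \<omega>) x) \<le> exp (\<beta> * h)"
    unfolding AE_all_countable by (rule allI, rule AE_flow[OF step])
  moreover have "AE \<omega> in M. \<forall>k. \<forall>x\<in>E. \<forall>t. alive t (\<theta> (real k * h) \<omega>) x \<and> \<bar>t\<bar> \<le> \<bar>h\<bar> \<longrightarrow>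
      mat_norm (\<Phi> t (\<theta> (real k * h) \<omega>) x) \<le> B"
    unfolding AE_all_countable by (rule allI, rule AE_flow[OF B(2)])
  ultimately have "AE \<omega> in M. \<forall>x\<in>E. \<forall>t. alive t \<omega> x \<and> 0 \<le> \<sigma> * t \<longrightarrow>
      mat_norm (\<Phi> t \<omega> x) \<le> K * exp (\<beta> * t)"
    using AE_regular
  proof eventually_elim
    case (elim \<omega>)
    have \<omega>: "\<omega> \<in> space M"
      using elim(4) by (simp add: regular_def)
    show ?case
    proof (intro ballI allI impI)
      fix x t assume x: "x \<in> E" and t: "alive t \<omega> x \<and> 0 \<le> \<sigma> * t"
      \<comment> \<open>As \<open>t\<close> and \<open>h\<close> have the same sign,
        \<open>s\<close> is nonnegative, and its floor \<open>n\<close> counts the full steps in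
        either direction of time.\<close>
      define s where "s = t / h"
      have th: "t = s * h"
        using \<open>h \<noteq> 0\<close> by (simp add: s_def)
      have "0 \<le> s"
        using h \<sigma> t by (auto simp: s_def zero_le_divide_iff)
      define n where "n = nat \<lfloor>s\<rfloor>"
      define r where "r = t - real n * h"
      have n: "real n \<le> s" "s < real n + 1"
        using \<open>0 \<le> s\<close> by (auto simp: n_def)
      have t_split: "t = r + real n * h"
        by (simp add: r_def)
      have "r = (s - real n) * h"
        by (simp add: r_def th algebra_simps)
      then have r: "\<bar>r\<bar> \<le> \<bar>h\<bar>"
        using n by (simp add: abs_mult mult_left_le_one_le)
      have nh: "alive (real n * h) \<omega> x"
        using t n unfolding th by (intro alive_multiple_le[OF \<omega> x, of "real n" s]) auto
      have rnh: "alive (r + real n * h) \<omega> x"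
        using t unfolding t_split[symmetric] ..
      have "mat_norm (\<Phi> t \<omega> x) =
          mat_norm (\<Phi> r (\<theta> (real n * h) \<omega>) (\<phi> (real n * h) \<omega> x) ** \<Phi> (real n * h) \<omega> x)"
        by (subst t_split, subst lin_cocycle_split[OF elim(4) elim(1)[rule_format] x nh rnh]) (rule refl)
      also have "\<dots> \<le> B * exp (\<beta> * h) ^ n"
      proof (rule mat_norm_mult_le)
        show "mat_norm (\<Phi> r (\<theta> (real n * h) \<omega>) (\<phi> (real n * h) \<omega> x)) \<le> B"
          using elim(3) r alive_in_E[OF elim(4) x nh] alive_shiftI[OF elim(4) x nh rnh] by blast
        show "mat_norm (\<Phi> (real n * h) \<omega> x) \<le> exp (\<beta> * h) ^ n"
          using mat_norm_lin_cocycle_multiple[OF _ _ \<omega> x nh] elim(1,2) by blast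
      qed
      also have "exp (\<beta> * h) ^ n = exp (- (\<beta> * r)) * exp (\<beta> * t)"
        by (simp add: r_def algebra_simps flip: exp_of_nat_mult exp_add)
      also have "B * (exp (- (\<beta> * r)) * exp (\<beta> * t)) \<le> (B * exp \<bar>\<beta> * h\<bar>) * exp (\<beta> * t)"
      proof -
        have "- (\<beta> * r) \<le> \<bar>\<beta>\<bar> * \<bar>r\<bar>"
          by (metis abs_ge_minus_self abs_mult)
        also have "\<dots> \<le> \<bar>\<beta>\<bar> * \<bar>h\<bar>"
          by (intro mult_left_mono r) simp
        finally show ?thesis
          using \<open>B > 0\<close> by (simp add: abs_mult)
      qed
      also have "\<dots> \<le> K * exp (\<beta> * t)"
        by (intro mult_right_mono) (auto simp: K_def)
      finally show "mat_norm (\<Phi> t \<omega> x) \<le> K * exp (\<beta> * t)" .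
    qed
  qed
  \<comment> \<open>The gap is \<open>\<sigma> * (\<gamma> - \<beta>)\<close>, positive by
    assumption; since \<open>\<sigma> * \<sigma> = 1\<close>, the exponent for \<gamma> is exactly
    \<beta>.\<close>
  then show ?thesis
    by (rule growth_boundI[of "\<sigma> * (\<gamma> - \<beta>)", rotated 3]) (use \<sigma> \<gamma> in \<open>auto simp: K_def\<close>)
qed

section \<open>Vanishing of idempotents along long orbits\<close>

lemma ex_of_positive_measure:
  assumes "AE \<omega> in M. P \<omega>" "measure M {\<omega> \<in> space M. Q \<omega>} > 0"
  shows "\<exists>\<omega>\<in>space M. P \<omega> \<and> Q \<omega>"
proof (rule ccontr)
  assume "\<not> ?thesis"
  with assms(1) have "AE \<omega> in M. \<not> (\<omega> \<in> {\<omega> \<in> space M. Q \<omega>})"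
    by (auto elim: eventually_mono)
  \<comment> \<open>Measurability comes for free: a set outside the sigma-algebra has
    \<open>measure\<close> 0 by convention.\<close>
  moreover have "{\<omega> \<in> space M. Q \<omega>} \<in> sets M"
    using assms(2) measure_notin_sets by fastforce
  ultimately have "emeasure M {\<omega> \<in> space M. Q \<omega>} = 0"
    by (subst AE_iff_measurable[symmetric, where P = "\<lambda>\<omega>. \<not> Q \<omega>"]) (auto elim: AE_mp)
  then show False
    using assms(2) by (simp add: measure_def)
qed

text \<open>
  Going forth and back along an orbit surviving up to a time \<open>t\<close> with \<open>\<sigma> t\<close> large shows that
  \<open>Q\<close> is a contraction at the starting point of the orbit.
\<close>
lemma idempotent_vanishes:
  fixes Q :: "'w \<times> (real^'n) \<Rightarrow> real^'n^'n"
  assumes \<sigma>: "\<sigma> = 1 \<or> \<sigma> = - 1" and x: "x \<in> E" and c: "\<sigma> * c < \<sigma> * c'"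
    and forward: "AE \<omega> in M. \<forall>x\<in>E. \<forall>t. alive t \<omega> x \<and> 0 \<le> \<sigma> * t \<longrightarrow>
      mat_norm (\<Phi> t \<omega> x ** Q (\<omega>, x)) \<le> K * exp (c * t)"
    and backward: "AE \<omega> in M. \<forall>x\<in>E. \<forall>t. alive t \<omega> x \<and> 0 \<le> - \<sigma> * t \<longrightarrow>
      mat_norm (\<Phi> t \<omega> x) \<le> K' * exp (c' * t)"
    and idem: "AE \<omega> in M. \<forall>x\<in>E. Q (\<omega>, x) ** Q (\<omega>, x) = Q (\<omega>, x)"
    and R: "AE \<omega> in M. R \<omega>"
  shows "\<exists>\<omega>. R \<omega> \<and> Q (\<omega>, x) = 0"
proof -
  \<comment> \<open>The product of the outward and the return bound has the negative exponent
    \<open>\<sigma> * (c - c') * s\<close>, so \<open>s\<close> can be chosen to make it less than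
    1.\<close>
  have "((\<lambda>s. K' * K * exp (\<sigma> * (c - c') * s)) \<longlongrightarrow> K' * K * 0) at_top"
  proof (intro tendsto_mult_left filterlim_compose[OF exp_at_bot])
    show "filterlim (\<lambda>s. \<sigma> * (c - c') * s) at_bot at_top"
      using c by (intro filterlim_tendsto_neg_mult_at_bot[OF tendsto_const _ filterlim_ident])
        (simp add: right_diff_distrib)
  qed
  then have "eventually (\<lambda>s. K' * K * exp (\<sigma> * (c - c') * s) < 1) at_top"
    by (auto dest: order_tendstoD(2)[of _ _ _ 1])
  then have "eventually (\<lambda>s. K' * K * exp (\<sigma> * (c - c') * s) < 1 \<and> 0 \<le> s) at_top"
    using eventually_ge_at_top by (rule eventually_conj)
  then obtain s where s: "K' * K * exp (\<sigma> * (c - c') * s) < 1" "0 \<le> s"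
    by (auto simp: eventually_at_top_linorder)
  define t where "t = \<sigma> * s"
  have t: "0 \<le> \<sigma> * t" "0 \<le> - \<sigma> * - t"
    using \<sigma> s by (auto simp: t_def)
  have pos: "measure M {\<omega> \<in> space M. alive t \<omega> x} > 0"
    using \<sigma>
  proof
    assume "\<sigma> = 1"
    then have "{\<omega> \<in> space M. alive t \<omega> x} = {\<omega>\<in>space M. Tp \<omega> x > ereal s}"
      using s x by (auto simp: t_def alive_iff_less_T_plus)
    then show ?thesis
      using T_plus_unbounded x s by simp
  next
    assume "\<sigma> = - 1"
    then have "{\<omega> \<in> space M. alive t \<omega> x} = {\<omega>\<in>space M. Tm \<omega> x < ereal (- s)}"
      using s x by (auto simp: t_def alive_iff_T_minus_less)
    then show ?thesis
      using T_minus_unbounded[rule_format, OF x, of "- s"] s by simp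
  qed
  \<comment> \<open>The outward bound is taken at \<omega>, but the return trip starts over
    \<open>\<theta> t \<omega>\<close>, hence the shifted version of
    \<open>backward\<close>.\<close>
  have AE: "AE \<omega> in M. (Q (\<omega>, x) ** Q (\<omega>, x) = Q (\<omega>, x) \<and> regular \<omega> \<and> regular (\<theta> t \<omega>) \<and> R \<omega>) \<and>
      (alive t \<omega> x \<longrightarrow> mat_norm (\<Phi> t \<omega> x ** Q (\<omega>, x)) \<le> K * exp (c * t)) \<and>
      (\<forall>y\<in>E. alive (- t) (\<theta> t \<omega>) y \<longrightarrow> mat_norm (\<Phi> (- t) (\<theta> t \<omega>) y) \<le> K' * exp (c' * - t))"
    using forward AE_flow[OF backward, of t] idem R AE_regular AE_flow[OF AE_regular, of t]
    by eventually_elim (use x t in blast)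
  from ex_of_positive_measure[OF AE pos] obtain \<omega> where "\<omega> \<in> space M" "alive t \<omega> x"
    and "(Q (\<omega>, x) ** Q (\<omega>, x) = Q (\<omega>, x) \<and> regular \<omega> \<and> regular (\<theta> t \<omega>) \<and> R \<omega>) \<and>
      (alive t \<omega> x \<longrightarrow> mat_norm (\<Phi> t \<omega> x ** Q (\<omega>, x)) \<le> K * exp (c * t)) \<and>
      (\<forall>y\<in>E. alive (- t) (\<theta> t \<omega>) y \<longrightarrow> mat_norm (\<Phi> (- t) (\<theta> t \<omega>) y) \<le> K' * exp (c' * - t))"
    by blast
  then have \<omega>: "Q (\<omega>, x) ** Q (\<omega>, x) = Q (\<omega>, x)" "regular \<omega>" "regular (\<theta> t \<omega>)" "R \<omega>"
    "alive t \<omega> x" "mat_norm (\<Phi> t \<omega> x ** Q (\<omega>, x)) \<le> K * exp (c * t)"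
    and bound: "\<forall>y\<in>E. alive (- t) (\<theta> t \<omega>) y \<longrightarrow> mat_norm (\<Phi> (- t) (\<theta> t \<omega>) y) \<le> K' * exp (c' * - t)"
    by simp_all
  let ?y = "\<phi> t \<omega> x"
  have "Q (\<omega>, x) = \<Phi> (- t) (\<theta> t \<omega>) ?y ** (\<Phi> t \<omega> x ** Q (\<omega>, x))"
    using lin_cocycle_inverse[OF \<omega>(2,3) x \<omega>(5)] by (simp add: matrix_mul_assoc)
  also have "mat_norm \<dots> \<le> (K' * exp (c' * - t)) * (K * exp (c * t))"
    by (intro mat_norm_mult_le \<omega>(6) bound[rule_format] alive_in_E alive_inverse \<omega> x)
  also have "\<dots> = K' * K * exp (\<sigma> * (c - c') * s)"
    by (simp add: t_def algebra_simps flip: exp_add)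
  finally have "mat_norm (Q (\<omega>, x)) < 1"
    using s by simp
  \<comment> \<open>Every vector \<open>?w\<close> in the range of an idempotent is fixed by it,
    which is incompatible with a norm less than 1 unless \<open>?w = 0\<close>.\<close>
  have "Q (\<omega>, x) *v v = 0" for v
  proof -
    let ?w = "Q (\<omega>, x) *v v"
    have "norm ?w \<le> mat_norm (Q (\<omega>, x)) * norm ?w"
      using norm_matrix_vector_mult_le[of "Q (\<omega>, x)" ?w] \<omega>(1) by (simp add: matrix_vector_mul_assoc)
    with \<open>mat_norm (Q (\<omega>, x)) < 1\<close> show ?thesis
      by (smt (verit, best) mult_left_le_one_le mult_less_cancel_right2 norm_le_zero_iff)
  qed
  then have "Q (\<omega>, x) = 0"
    by (simp add: matrix_eq)
  with \<omega>(4) show ?thesis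
    by blast
qed

end

section \<open>Finite-time Lyapunov exponents and the spectrum\<close>

lemma esssup_on_le: "AE \<omega> in M. \<omega> \<in> A \<longrightarrow> f \<omega> \<le> c \<Longrightarrow> esssup_on M A f \<le> c"
  unfolding esssup_on_def by (rule Inf_lower) simp

text \<open>The strict inequality yields an admissible bound \<open>c'\<close> below
  \<open>c\<close>, so it does not matter whether the infimum defining the essential supremum is
  attained.\<close>

lemma AE_of_esssup_on_less:
  assumes "esssup_on M A f < c"
  shows "AE \<omega> in M. \<omega> \<in> A \<longrightarrow> f \<omega> \<le> c"
proof -
  from assms obtain c' where c': "AE \<omega> in M. \<omega> \<in> A \<longrightarrow> f \<omega> \<le> c'" "c' < c"
    unfolding esssup_on_def Inf_less_iff by auto
  from c'(1) show ?thesis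
    by eventually_elim (use c'(2) in auto)
qed

lemma essinf_on_ge: "AE \<omega> in M. \<omega> \<in> A \<longrightarrow> c \<le> f \<omega> \<Longrightarrow> c \<le> essinf_on M A f"
  unfolding essinf_on_def by (rule Sup_upper) simp

lemma AE_of_less_essinf_on:
  assumes "c < essinf_on M A f"
  shows "AE \<omega> in M. \<omega> \<in> A \<longrightarrow> c \<le> f \<omega>"
proof -
  from assms obtain c' where c': "AE \<omega> in M. \<omega> \<in> A \<longrightarrow> c' \<le> f \<omega>" "c < c'"
    unfolding essinf_on_def less_Sup_iff by auto
  from c'(1) show ?thesis
    by eventually_elim (use c'(2) in auto)
qed

lemma ftle_le_iff:
  assumes "t > 0" "v \<noteq> 0" "lin_cocycle \<phi> t \<omega> x *v v \<noteq> 0"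
  shows "ftle \<phi> v t \<omega> x \<le> b \<longleftrightarrow> norm (lin_cocycle \<phi> t \<omega> x *v v) \<le> exp (b * t) * norm v"
proof -
  have "ftle \<phi> v t \<omega> x \<le> b \<longleftrightarrow> ln (norm (lin_cocycle \<phi> t \<omega> x *v v) / norm v) \<le> b * t"
    using assms(1) by (simp add: ftle_def field_simps)
  also have "\<dots> \<longleftrightarrow> norm (lin_cocycle \<phi> t \<omega> x *v v) / norm v \<le> exp (b * t)"
    using assms by (subst exp_le_cancel_iff[symmetric]) simp
  also have "\<dots> \<longleftrightarrow> norm (lin_cocycle \<phi> t \<omega> x *v v) \<le> exp (b * t) * norm v"
    using assms by (simp add: field_simps)
  finally show ?thesis .
qed

lemma ftle_ge_iff:
  assumes "t > 0" "v \<noteq> 0" "lin_cocycle \<phi> t \<omega> x *v v \<noteq> 0"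
  shows "b \<le> ftle \<phi> v t \<omega> x \<longleftrightarrow> exp (b * t) * norm v \<le> norm (lin_cocycle \<phi> t \<omega> x *v v)"
proof -
  have "b \<le> ftle \<phi> v t \<omega> x \<longleftrightarrow> b * t \<le> ln (norm (lin_cocycle \<phi> t \<omega> x *v v) / norm v)"
    using assms(1) by (simp add: ftle_def field_simps)
  also have "\<dots> \<longleftrightarrow> exp (b * t) \<le> norm (lin_cocycle \<phi> t \<omega> x *v v) / norm v"
    using assms by (subst ln_ge_iff) auto
  also have "\<dots> \<longleftrightarrow> exp (b * t) * norm v \<le> norm (lin_cocycle \<phi> t \<omega> x *v v)"
    using assms by (simp add: field_simps)
  finally show ?thesis .
qed

text \<open>To be read with \<open>A\<close> as admitting a dichotomy and \<open>U\<close> as the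
  rates with projector \<open>Id\<close>. Everything above a member of \<open>U\<close> is
  admissible. If the complement of \<open>A\<close> stayed strictly below the infimum of
  \<open>U\<close>, that infimum would be admissible, belong to \<open>U\<close> by
  \<open>cl\<close>, and contradict \<open>op\<close>.\<close>

lemma Sup_complement_eq_Inf:
  fixes A :: "ereal \<Rightarrow> bool" and U :: "real set"
  assumes up: "\<And>u u'. u \<in> U \<Longrightarrow> u \<le> u' \<Longrightarrow> u' \<in> U"
    and op: "\<And>u. u \<in> U \<Longrightarrow> \<exists>u'\<in>U. u' < u"
    and cl: "\<And>g. A (ereal g) \<Longrightarrow> (\<forall>g'>g. g' \<in> U) \<Longrightarrow> g \<in> U"
    and adm: "\<And>u. u \<in> U \<Longrightarrow> A (ereal u)"
    and top: "A \<infinity> \<Longrightarrow> U \<noteq> {}"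
    and fin: "Sup {\<gamma>. \<not> A \<gamma>} < \<infinity>"
  shows "Sup {\<gamma>. \<not> A \<gamma>} = Inf (ereal ` U)"
proof (rule antisym)
  have "A \<infinity>"
    using fin Sup_upper[of \<infinity> "{\<gamma>. \<not> A \<gamma>}"] by auto
  show "Sup {\<gamma>. \<not> A \<gamma>} \<le> Inf (ereal ` U)"
  proof (intro Sup_least Inf_greatest)
    fix \<gamma> z assume \<gamma>: "\<gamma> \<in> {\<gamma>. \<not> A \<gamma>}" and "z \<in> ereal ` U"
    then obtain u where u: "z = ereal u" "u \<in> U"
      by auto
    show "\<gamma> \<le> z"
    proof (cases \<gamma>)
      case (real g)
      have "\<not> u \<le> g"
        using up[OF u(2)] adm \<gamma> real by auto
      then show ?thesis
        using real u by simp
    qed (use \<gamma> \<open>A \<infinity>\<close> in auto)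
  qed
  show "Inf (ereal ` U) \<le> Sup {\<gamma>. \<not> A \<gamma>}"
  proof (rule ccontr)
    assume "\<not> ?thesis"
    then have less: "Sup {\<gamma>. \<not> A \<gamma>} < Inf (ereal ` U)"
      by simp
    obtain u where u: "u \<in> U"
      using top[OF \<open>A \<infinity>\<close>] by auto
    then have "Inf (ereal ` U) \<le> ereal u"
      by (intro Inf_lower) auto
    \<comment> \<open>The infimum is real: it is at most \<open>u\<close>, and it strictly exceeds
      another extended real.\<close>
    then obtain a where a: "Inf (ereal ` U) = ereal a"
      using less by (cases "Inf (ereal ` U)") auto
    have "A (ereal a)"
      using less Sup_upper[of "ereal a" "{\<gamma>. \<not> A \<gamma>}"] unfolding a by (auto simp: not_less[symmetric])
    moreover have "g' \<in> U" if "g' > a" for g'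
    proof -
      have "Inf (ereal ` U) < ereal g'"
        using that by (simp add: a)
      then obtain w where "w \<in> U" "w < g'"
        by (auto simp: Inf_less_iff)
      then show ?thesis
        using up by auto
    qed
    ultimately have "a \<in> U"
      by (intro cl) auto
    then obtain w where "w \<in> U" "w < a"
      using op by blast
    moreover from \<open>w \<in> U\<close> have "Inf (ereal ` U) \<le> ereal w"
      by (intro Inf_lower) auto
    ultimately show False
      by (simp add: a)
  qed
qed

text \<open>The reflection \<gamma> to -\<gamma> turns this into
  \<open>Sup_complement_eq_Inf\<close>.\<close>

lemma Inf_complement_eq_Sup:
  fixes A :: "ereal \<Rightarrow> bool" and U :: "real set"
  assumes down: "\<And>u u'. u \<in> U \<Longrightarrow> u' \<le> u \<Longrightarrow> u' \<in> U"
    and op: "\<And>u. u \<in> U \<Longrightarrow> \<exists>u'\<in>U. u < u'"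
    and cl: "\<And>g. A (ereal g) \<Longrightarrow> (\<forall>g'<g. g' \<in> U) \<Longrightarrow> g \<in> U"
    and adm: "\<And>u. u \<in> U \<Longrightarrow> A (ereal u)"
    and bot: "A (- \<infinity>) \<Longrightarrow> U \<noteq> {}"
    and fin: "- \<infinity> < Inf {\<gamma>. \<not> A \<gamma>}"
  shows "Inf {\<gamma>. \<not> A \<gamma>} = Sup (ereal ` U)"
proof -
  have S: "{\<gamma>. \<not> A (- \<gamma>)} = uminus ` {\<gamma>. \<not> A \<gamma>}"
    by (auto simp: image_iff intro!: exI[of _ "- _"])
  have "Sup {\<gamma>. \<not> A (- \<gamma>)} = Inf (ereal ` uminus ` U)"
  proof (rule Sup_complement_eq_Inf)
    show "u' \<in> uminus ` U" if "u \<in> uminus ` U" "u \<le> u'" for u u'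
      using that down[of "- u" "- u'"] by (force simp: image_iff)
    show "\<exists>u'\<in>uminus ` U. u' < u" if "u \<in> uminus ` U" for u
      using that op[of "- u"] by (force simp: image_iff)
    show "g \<in> uminus ` U" if "A (- ereal g)" "\<forall>g'>g. g' \<in> uminus ` U" for g
    proof -
      have "g' \<in> U" if "g' < - g" for g'
        using \<open>\<forall>g'>g. g' \<in> uminus ` U\<close>[rule_format, of "- g'"] that by auto
      then have "- g \<in> U"
        using that(1) by (intro cl) auto
      then show ?thesis
        by (force simp: image_iff)
    qed
    show "Sup {\<gamma>. \<not> A (- \<gamma>)} < \<infinity>"
      using fin unfolding S ereal_Sup_uminus_image_eq by (cases "Inf {\<gamma>. \<not> A \<gamma>}") auto
  qed (use adm bot in auto)
  moreover have "ereal ` uminus ` U = uminus ` ereal ` U"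
    by (simp add: image_image)
  ultimately show ?thesis
    unfolding S by (simp only: ereal_Sup_uminus_image_eq ereal_Inf_uminus_image_eq ereal_uminus_eq_iff)
qed

text \<open>The convergence criterion in the order topology, which also covers infinite limits. The
  lower bound holds at each positive time, while each upper bound \<open>u\<close> is only needed
  for large times.\<close>

lemma tendsto_Inf_at_top:
  fixes F :: "real \<Rightarrow> ereal"
  assumes "\<And>t. t > 0 \<Longrightarrow> Inf S \<le> F t" "\<And>u. u \<in> S \<Longrightarrow> eventually (\<lambda>t. F t \<le> u) at_top"
  shows "(F \<longlongrightarrow> Inf S) at_top"
proof (rule order_tendstoI)
  fix a assume "a < Inf S"
  show "eventually (\<lambda>t. a < F t) at_top"
    using eventually_gt_at_top[of 0]
    by eventually_elim (rule less_le_trans[OF \<open>a < Inf S\<close> assms(1)])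
next
  fix a assume "Inf S < a"
  then obtain u where "u \<in> S" "u < a"
    by (auto simp: Inf_less_iff)
  with assms(2)[OF this(1)] show "eventually (\<lambda>t. F t < a) at_top"
    by (auto elim!: eventually_mono)
qed

lemma tendsto_Sup_at_top:
  fixes F :: "real \<Rightarrow> ereal"
  assumes "\<And>t. t > 0 \<Longrightarrow> F t \<le> Sup S" "\<And>u. u \<in> S \<Longrightarrow> eventually (\<lambda>t. u \<le> F t) at_top"
  shows "(F \<longlongrightarrow> Sup S) at_top"
proof (rule order_tendstoI)
  fix a assume "Sup S < a"
  show "eventually (\<lambda>t. F t < a) at_top"
    using eventually_gt_at_top[of 0]
    by eventually_elim (rule le_less_trans[OF assms(1) \<open>Sup S < a\<close>])
next
  fix a assume "a < Sup S"
  then obtain u where "u \<in> S" "a < u"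
    by (auto simp: less_Sup_iff)
  with assms(2)[OF this(1)] show "eventually (\<lambda>t. a < F t) at_top"
    by (auto elim!: eventually_mono)
qed

section \<open>Dichotomies with trivial projectors and their effect on the exponents\<close>

context local_rds
begin

text \<open>Separates the two estimates and writes the time constraints with the factors
  \<open>1\<close> and \<open>- 1\<close>, to match \<open>growth_bound\<close> and
  \<open>idempotent_vanishes\<close>.\<close>

lemma dichotomy_with_iff:
  "dichotomy_with M \<theta> E D \<phi> \<gamma> P \<longleftrightarrow> invariant_projector M \<theta> E D \<phi> P \<and>
     (\<exists>\<alpha>>0. \<exists>K\<ge>1.
       (AE \<omega> in M. \<forall>x\<in>E. \<forall>t. alive t \<omega> x \<and> 0 \<le> 1 * t \<longrightarrow>
          mat_norm (\<Phi> t \<omega> x ** P (\<omega>, x)) \<le> K * exp ((\<gamma> - \<alpha>) * t)) \<and>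
       (AE \<omega> in M. \<forall>x\<in>E. \<forall>t. alive t \<omega> x \<and> 0 \<le> - 1 * t \<longrightarrow>
          mat_norm (\<Phi> t \<omega> x ** (mat 1 - P (\<omega>, x))) \<le> K * exp ((\<gamma> + \<alpha>) * t)))"
proof -
  have "(AE \<omega> in M. \<forall>x\<in>E.
        (\<forall>t. 0 \<le> t \<and> ereal t < Tp \<omega> x \<longrightarrow> mat_norm (\<Phi> t \<omega> x ** P (\<omega>, x)) \<le> a t) \<and>
        (\<forall>t. t \<le> 0 \<and> Tm \<omega> x < ereal t \<longrightarrow> mat_norm (\<Phi> t \<omega> x ** (mat 1 - P (\<omega>, x))) \<le> b t)) \<longleftrightarrow>
      (AE \<omega> in M. \<forall>x\<in>E. \<forall>t. alive t \<omega> x \<and> 0 \<le> 1 * t \<longrightarrow> mat_norm (\<Phi> t \<omega> x ** P (\<omega>, x)) \<le> a t) \<and>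
      (AE \<omega> in M. \<forall>x\<in>E. \<forall>t. alive t \<omega> x \<and> 0 \<le> - 1 * t \<longrightarrow>
        mat_norm (\<Phi> t \<omega> x ** (mat 1 - P (\<omega>, x))) \<le> b t)"
    for a b :: "real \<Rightarrow> real"
    unfolding AE_conj_iff[symmetric]
    by (intro AE_cong) (auto simp: alive_iff_less_T_plus alive_iff_T_minus_less)
  then show ?thesis
    unfolding dichotomy_with_def by simp
qed

text \<open>With projector \<open>Id\<close> the estimate for negative times concerns the zero
  matrix and is trivial.\<close>

lemma dichotomy_with_one_iff: "dichotomy_with M \<theta> E D \<phi> \<gamma> (\<lambda>_. mat 1) \<longleftrightarrow> growth_bound 1 \<gamma>"
proof -
  have "invariant_projector M \<theta> E D \<phi> (\<lambda>_. mat 1)"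
    unfolding invariant_projector_def by (auto simp: rank_I)
  then show ?thesis
    unfolding dichotomy_with_iff growth_bound_def
    by (simp add: mat_norm_zero zero_le_mult_iff cong: conj_cong)
qed

lemma dichotomy_with_zero_iff: "dichotomy_with M \<theta> E D \<phi> \<gamma> (\<lambda>_. 0) \<longleftrightarrow> growth_bound (- 1) \<gamma>"
proof -
  have "0 ** A = 0" "A ** 0 = 0" for A :: "real^'n^'n"
    by (simp_all add: matrix_eq flip: matrix_vector_mul_assoc)
  moreover from this have "invariant_projector M \<theta> E D \<phi> (\<lambda>_. 0)"
    unfolding invariant_projector_def by auto
  ultimately show ?thesis
    unfolding dichotomy_with_iff growth_bound_def
    by (simp add: mat_norm_zero zero_le_mult_iff cong: conj_cong)
qed

lemma growth_bound_empty: "E = {} \<Longrightarrow> growth_bound \<sigma> \<gamma>"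
  by (rule growth_boundI[of 1 1]) auto

text \<open>Needed because \<open>ln 0 = 0\<close> would give a wrong finite-time exponent for \<open>v\<close> in the kernel.\<close>
lemma AE_lin_cocycle_nonzero:
  "AE \<omega> in M. \<forall>x\<in>E. alive t \<omega> x \<longrightarrow> (\<forall>v. v \<noteq> 0 \<longrightarrow> \<Phi> t \<omega> x *v v \<noteq> 0)"
  using AE_regular AE_flow[OF AE_regular, of t]
proof eventually_elim
  case (elim \<omega>)
  show ?case
  proof (intro ballI allI impI notI)
    fix x v assume x: "x \<in> E" "alive t \<omega> x" and v: "v \<noteq> 0" "\<Phi> t \<omega> x *v v = 0"
    have "v = \<Phi> (- t) (\<theta> t \<omega>) (\<phi> t \<omega> x) ** \<Phi> t \<omega> x *v v"
      unfolding lin_cocycle_inverse[OF elim x] by simp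
    also have "\<dots> = 0"
      unfolding matrix_vector_mul_assoc[symmetric] v(2) by simp
    finally show False
      using v(1) by simp
  qed
qed

text \<open>For large times the constant \<open>K\<close> of a growth bound is absorbed by the
  surplus rate \<alpha>.\<close>

lemma eventually_le_exp:
  fixes \<alpha> :: real
  assumes "\<alpha> > 0"
  shows "eventually (\<lambda>t. K \<le> exp (\<alpha> * t)) at_top"
proof -
  have "filterlim (\<lambda>t. exp (\<alpha> * t)) at_top at_top"
    using assms by (intro filterlim_compose[OF exp_at_top] filterlim_tendsto_pos_mult_at_top[OF tendsto_const] filterlim_ident)
  then show ?thesis
    by (auto simp: filterlim_at_top)
qed

definition upper_ftle :: "real \<Rightarrow> ereal" where
  "upper_ftle t = (SUP x\<in>E. esssup_on M {\<omega>\<in>space M. Tp \<omega> x > ereal t}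
     (\<lambda>\<omega>. SUP v\<in>{v. v \<noteq> 0}. ereal (ftle \<phi> v t \<omega> x)))"

definition lower_ftle :: "real \<Rightarrow> ereal" where
  "lower_ftle t = (INF x\<in>E. essinf_on M {\<omega>\<in>space M. Tp \<omega> x > ereal t}
     (\<lambda>\<omega>. INF v\<in>{v. v \<noteq> 0}. ereal (ftle \<phi> v t \<omega> x)))"

lemma eventually_upper_ftle_le:
  assumes "growth_bound 1 \<gamma>"
  shows "eventually (\<lambda>t. upper_ftle t \<le> ereal \<gamma>) at_top"
proof -
  from assms obtain \<alpha> K where \<alpha>: "\<alpha> > 0"
    and AE: "AE \<omega> in M. \<forall>x\<in>E. \<forall>t. alive t \<omega> x \<and> 0 \<le> 1 * t \<longrightarrow>
      mat_norm (\<Phi> t \<omega> x) \<le> K * exp ((\<gamma> - 1 * \<alpha>) * t)"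
    unfolding growth_bound_def by auto
  show ?thesis
    using eventually_le_exp[OF \<alpha>, of K] eventually_gt_at_top[of 0]
  proof eventually_elim
    case (elim t)
    have "K * exp ((\<gamma> - 1 * \<alpha>) * t) \<le> exp (\<alpha> * t) * exp ((\<gamma> - 1 * \<alpha>) * t)"
      by (intro mult_right_mono elim) simp
    also have "\<dots> = exp (\<gamma> * t)"
      by (simp add: algebra_simps flip: exp_add)
    finally have le: "K * exp ((\<gamma> - 1 * \<alpha>) * t) \<le> exp (\<gamma> * t)" .
    show ?case
      unfolding upper_ftle_def
    proof (intro SUP_least esssup_on_le)
      fix x assume x: "x \<in> E"
      show "AE \<omega> in M. \<omega> \<in> {\<omega>\<in>space M. Tp \<omega> x > ereal t} \<longrightarrow>
          (SUP v\<in>{v. v \<noteq> 0}. ereal (ftle \<phi> v t \<omega> x)) \<le> ereal \<gamma>"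
        using AE AE_lin_cocycle_nonzero[of t]
      proof eventually_elim
        case *: (elim \<omega>)
        show ?case
        proof (intro impI SUP_least)
          fix v :: "real^'n" assume "\<omega> \<in> {\<omega>\<in>space M. Tp \<omega> x > ereal t}" and v: "v \<in> {v. v \<noteq> 0}"
          then have al: "alive t \<omega> x"
            using elim(2) x by (simp add: alive_iff_less_T_plus)
          then have "mat_norm (\<Phi> t \<omega> x) \<le> exp (\<gamma> * t)"
            using *(1) x elim(2) le by fastforce
          then show "ereal (ftle \<phi> v t \<omega> x) \<le> ereal \<gamma>"
            using *(2) x al v elim(2) by (simp add: ftle_le_iff mat_norm_le_iff)
        qed
      qed
    qed
  qed
qed

text \<open>The bound for negative times is applied at the endpoint of the orbit segment. There
  \<open>\<Phi> (- t)\<close> inverts \<open>\<Phi> t\<close>, so a norm at most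
  \<open>exp (- (\<gamma> * t))\<close> of the inverse means expansion by at least
  \<open>exp (\<gamma> * t)\<close>.\<close>

lemma eventually_lower_ftle_ge:
  assumes "growth_bound (- 1) \<gamma>"
  shows "eventually (\<lambda>t. ereal \<gamma> \<le> lower_ftle t) at_top"
proof -
  from assms obtain \<alpha> K where \<alpha>: "\<alpha> > 0"
    and AE: "AE \<omega> in M. \<forall>x\<in>E. \<forall>t. alive t \<omega> x \<and> 0 \<le> - 1 * t \<longrightarrow>
      mat_norm (\<Phi> t \<omega> x) \<le> K * exp ((\<gamma> - - 1 * \<alpha>) * t)"
    unfolding growth_bound_def by auto
  show ?thesis
    using eventually_le_exp[OF \<alpha>, of K] eventually_gt_at_top[of 0]
  proof eventually_elim
    case (elim t)
    have "K * exp ((\<gamma> - - 1 * \<alpha>) * - t) \<le> exp (\<alpha> * t) * exp ((\<gamma> - - 1 * \<alpha>) * - t)"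
      by (intro mult_right_mono elim) simp
    also have "\<dots> = exp (- (\<gamma> * t))"
      by (simp add: algebra_simps flip: exp_add)
    finally have le: "K * exp ((\<gamma> - - 1 * \<alpha>) * - t) \<le> exp (- (\<gamma> * t))" .
    show ?case
      unfolding lower_ftle_def
    proof (intro INF_greatest essinf_on_ge)
      fix x assume x: "x \<in> E"
      show "AE \<omega> in M. \<omega> \<in> {\<omega>\<in>space M. Tp \<omega> x > ereal t} \<longrightarrow>
          ereal \<gamma> \<le> (INF v\<in>{v. v \<noteq> 0}. ereal (ftle \<phi> v t \<omega> x))"
        using AE_flow[OF AE, of t] AE_lin_cocycle_nonzero[of t] AE_regular AE_flow[OF AE_regular, of t]
      proof eventually_elim
        case *: (elim \<omega>)
        show ?case
        proof (intro impI INF_greatest)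
          fix v :: "real^'n" assume "\<omega> \<in> {\<omega>\<in>space M. Tp \<omega> x > ereal t}" and v: "v \<in> {v. v \<noteq> 0}"
          then have al: "alive t \<omega> x"
            using elim(2) x by (simp add: alive_iff_less_T_plus)
          let ?A = "\<Phi> (- t) (\<theta> t \<omega>) (\<phi> t \<omega> x)"
          have "mat_norm ?A \<le> exp (- (\<gamma> * t))"
            using *(1)[rule_format, OF alive_in_E[OF *(3) x al], of "- t"]
              alive_inverse[OF *(3,4) x al] elim(2) le by simp
          then have "norm (?A *v (\<Phi> t \<omega> x *v v)) \<le> exp (- (\<gamma> * t)) * norm (\<Phi> t \<omega> x *v v)"
            by (simp add: mat_norm_le_iff)
          then have "norm v \<le> exp (- (\<gamma> * t)) * norm (\<Phi> t \<omega> x *v v)"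
            by (simp add: matrix_vector_mul_assoc lin_cocycle_inverse[OF *(3,4) x al])
          then have "exp (\<gamma> * t) * norm v \<le> norm (\<Phi> t \<omega> x *v v)"
            by (simp add: exp_minus field_simps)
          then show "ereal \<gamma> \<le> ereal (ftle \<phi> v t \<omega> x)"
            using *(2) x al v elim(2) by (simp add: ftle_ge_iff)
        qed
      qed
    qed
  qed
qed

end

section \<open>Growth bounds and the ends of the spectrum\<close>

context hitting_rds
begin

text \<open>
  Since the rank of \<open>P\<close> is almost surely constant, it is enough to find one point with
  \<open>P = Id\<close> (in the next lemma, \<open>P = 0\<close>).
\<close>
lemma growth_bound_plus_closed:
  assumes P: "dichotomy_with M \<theta> E D \<phi> \<gamma> P" and gb: "\<forall>\<gamma>'>\<gamma>. growth_bound 1 \<gamma>'"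
  shows "growth_bound 1 \<gamma>"
proof (cases "E = {}")
  case False
  then obtain x where x: "x \<in> E"
    by auto
  from P obtain \<alpha> K where \<alpha>: "\<alpha> > 0" "K \<ge> 1"
    and fw: "AE \<omega> in M. \<forall>x\<in>E. \<forall>t. alive t \<omega> x \<and> 0 \<le> 1 * t \<longrightarrow>
          mat_norm (\<Phi> t \<omega> x ** P (\<omega>, x)) \<le> K * exp ((\<gamma> - \<alpha>) * t)"
    and bw: "AE \<omega> in M. \<forall>x\<in>E. \<forall>t. alive t \<omega> x \<and> 0 \<le> - 1 * t \<longrightarrow>
          mat_norm (\<Phi> t \<omega> x ** (mat 1 - P (\<omega>, x))) \<le> K * exp ((\<gamma> + \<alpha>) * t)"
    unfolding dichotomy_with_iff by blast
  from P obtain r where idem: "AE \<omega> in M. \<forall>x\<in>E. P (\<omega>, x) ** P (\<omega>, x) = P (\<omega>, x)"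
    and rank: "AE \<omega> in M. \<forall>x\<in>E. rank (P (\<omega>, x)) = r"
    unfolding dichotomy_with_def invariant_projector_def by blast
  \<comment> \<open>A rate above \<gamma>, so that \<open>gb\<close> applies, but below
    \<open>\<gamma> + \<alpha>\<close>, so that forward growth loses against the backward decay on
    the kernel of \<open>P\<close>.\<close>
  from gb \<alpha> have "growth_bound 1 (\<gamma> + \<alpha> / 2)"
    by simp
  then obtain \<alpha>' K' where \<alpha>': "\<alpha>' > 0"
    and gb': "AE \<omega> in M. \<forall>x\<in>E. \<forall>t. alive t \<omega> x \<and> 0 \<le> 1 * t \<longrightarrow>
      mat_norm (\<Phi> t \<omega> x) \<le> K' * exp ((\<gamma> + \<alpha> / 2 - 1 * \<alpha>') * t)"
    unfolding growth_bound_def by blast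
  have "\<exists>\<omega>. (\<forall>x\<in>E. rank (P (\<omega>, x)) = r) \<and> mat 1 - P (\<omega>, x) = 0"
  \<comment> \<open>With \<sigma> = -1 the outward trip runs in negative time, where
    \<open>bw\<close> controls \<open>Id - P\<close>, and the growth bound controls the
    return.\<close>
  proof (rule idempotent_vanishes[where Q = "\<lambda>p. mat 1 - P p" and \<sigma> = "- 1", OF _ x _ bw _ _ rank])
    show "AE \<omega> in M. \<forall>x\<in>E. (mat 1 - P (\<omega>, x)) ** (mat 1 - P (\<omega>, x)) = mat 1 - P (\<omega>, x)"
      using idem
      by eventually_elim (simp add: matrix_eq matrix_vector_mult_diff_rdistrib matrix_vector_mult_diff_distrib
        flip: matrix_vector_mul_assoc)
    show "AE \<omega> in M. \<forall>x\<in>E. \<forall>t. alive t \<omega> x \<and> 0 \<le> - (- 1) * t \<longrightarrow>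
        mat_norm (\<Phi> t \<omega> x) \<le> K' * exp ((\<gamma> + \<alpha> / 2 - 1 * \<alpha>') * t)"
      using gb' by simp
  qed (use \<alpha> \<alpha>' in auto)
  then obtain \<omega> where "rank (P (\<omega>, x)) = r" "P (\<omega>, x) = mat 1"
    using x by auto
  \<comment> \<open>The rank found at one point is the almost sure rank everywhere, so
    \<open>P\<close> has full rank and is \<open>Id\<close> throughout.\<close>
  then have r: "r = CARD('n)"
    by (metis rank_I)
  have "AE \<omega> in M. \<forall>x\<in>E. \<forall>t. alive t \<omega> x \<and> 0 \<le> 1 * t \<longrightarrow>
          mat_norm (\<Phi> t \<omega> x) \<le> K * exp ((\<gamma> - \<alpha>) * t)"
    using fw idem rank
  proof eventually_elim
    case (elim \<omega>)
    then have "P (\<omega>, x) = mat 1" if "x \<in> E" for x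
      using that r by (intro idempotent_full_rank_eq_one) auto
    with elim(1) show ?case
      by simp
  qed
  then show ?thesis
    by (rule growth_boundI[OF \<alpha>, rotated]) simp
qed (rule growth_bound_empty)

text \<open>Here the range of \<open>P\<close> is tested: its vectors decay forward at rate
  \<open>\<gamma> - \<alpha>\<close>, and the backward bound at a rate above
  \<open>\<gamma> - \<alpha> / 2\<close> cannot restore them.\<close>

lemma growth_bound_minus_closed:
  assumes P: "dichotomy_with M \<theta> E D \<phi> \<gamma> P" and gb: "\<forall>\<gamma>'<\<gamma>. growth_bound (- 1) \<gamma>'"
  shows "growth_bound (- 1) \<gamma>"
proof (cases "E = {}")
  case False
  then obtain x where x: "x \<in> E"
    by auto
  from P obtain \<alpha> K where \<alpha>: "\<alpha> > 0" "K \<ge> 1"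
    and fw: "AE \<omega> in M. \<forall>x\<in>E. \<forall>t. alive t \<omega> x \<and> 0 \<le> 1 * t \<longrightarrow>
          mat_norm (\<Phi> t \<omega> x ** P (\<omega>, x)) \<le> K * exp ((\<gamma> - \<alpha>) * t)"
    and bw: "AE \<omega> in M. \<forall>x\<in>E. \<forall>t. alive t \<omega> x \<and> 0 \<le> - 1 * t \<longrightarrow>
          mat_norm (\<Phi> t \<omega> x ** (mat 1 - P (\<omega>, x))) \<le> K * exp ((\<gamma> + \<alpha>) * t)"
    unfolding dichotomy_with_iff by blast
  from P obtain r where idem: "AE \<omega> in M. \<forall>x\<in>E. P (\<omega>, x) ** P (\<omega>, x) = P (\<omega>, x)"
    and rank: "AE \<omega> in M. \<forall>x\<in>E. rank (P (\<omega>, x)) = r"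
    unfolding dichotomy_with_def invariant_projector_def by blast
  from gb \<alpha> have "growth_bound (- 1) (\<gamma> - \<alpha> / 2)"
    by simp
  then obtain \<alpha>' K' where \<alpha>': "\<alpha>' > 0"
    and gb': "AE \<omega> in M. \<forall>x\<in>E. \<forall>t. alive t \<omega> x \<and> 0 \<le> - 1 * t \<longrightarrow>
      mat_norm (\<Phi> t \<omega> x) \<le> K' * exp ((\<gamma> - \<alpha> / 2 - - 1 * \<alpha>') * t)"
    unfolding growth_bound_def by blast
  have "\<exists>\<omega>. (\<forall>x\<in>E. rank (P (\<omega>, x)) = r) \<and> P (\<omega>, x) = 0"
    by (rule idempotent_vanishes[where \<sigma> = 1, OF _ x _ fw gb' idem rank]) (use \<alpha> \<alpha>' in auto)
  then obtain \<omega> where "rank (P (\<omega>, x)) = r" "P (\<omega>, x) = 0"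
    using x by auto
  then have r: "r = 0"
    by (metis rank_0)
  have "AE \<omega> in M. \<forall>x\<in>E. \<forall>t. alive t \<omega> x \<and> 0 \<le> - 1 * t \<longrightarrow>
          mat_norm (\<Phi> t \<omega> x) \<le> K * exp ((\<gamma> + \<alpha>) * t)"
    using bw rank
  proof eventually_elim
    case (elim \<omega>)
    then have "P (\<omega>, x) = 0" if "x \<in> E" for x
      using that r by (simp add: rank_eq_0)
    with elim(1) show ?case
      by simp
  qed
  then show ?thesis
    by (rule growth_boundI[OF \<alpha>, rotated]) simp
qed (rule growth_bound_empty)

lemma Sup_spectrum:
  assumes "Sup (dichotomy_spectrum M \<theta> E D \<phi>) < \<infinity>"
  shows "Sup (dichotomy_spectrum M \<theta> E D \<phi>) = Inf (ereal ` {\<gamma>. growth_bound 1 \<gamma>})"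
  unfolding dichotomy_spectrum_def
proof (rule Sup_complement_eq_Inf)
  show "u' \<in> {\<gamma>. growth_bound 1 \<gamma>}" if "u \<in> {\<gamma>. growth_bound 1 \<gamma>}" "u \<le> u'" for u u'
    using that growth_bound_mono[of 1 u u'] by simp
  show "\<exists>u'\<in>{\<gamma>. growth_bound 1 \<gamma>}. u' < u" if "u \<in> {\<gamma>. growth_bound 1 \<gamma>}" for u
  proof -
    from that have "growth_bound 1 u"
      by simp
    then obtain \<delta> where "\<delta> > 0" "growth_bound 1 (u - 1 * \<delta>)"
      by (rule growth_bound_open)
    then show ?thesis
      by (intro bexI[of _ "u - \<delta>"]) auto
  qed
  show "Sup {\<gamma>. \<not> admits_dichotomy M \<theta> E D \<phi> \<gamma>} < \<infinity>"
    using assms unfolding dichotomy_spectrum_def .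
  show "admits_dichotomy M \<theta> E D \<phi> (ereal u)" if "u \<in> {\<gamma>. growth_bound 1 \<gamma>}" for u
    unfolding admits_dichotomy_def ereal.case
    by (rule exI[of _ "\<lambda>_. mat 1"]) (use that in \<open>simp add: dichotomy_with_one_iff\<close>)
  show "g \<in> {\<gamma>. growth_bound 1 \<gamma>}"
    if "admits_dichotomy M \<theta> E D \<phi> (ereal g)" "\<forall>g'>g. g' \<in> {\<gamma>. growth_bound 1 \<gamma>}" for g
  proof -
    from that(1) obtain P where "dichotomy_with M \<theta> E D \<phi> g P"
      unfolding admits_dichotomy_def by auto
    from growth_bound_plus_closed[OF this] that(2) show ?thesis
      by simp
  qed
  \<comment> \<open>By definition, admitting the rate \<infinity> provides some real rate with
    projector \<open>Id\<close>.\<close>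
  show "{\<gamma>. growth_bound 1 \<gamma>} \<noteq> {}" if "admits_dichotomy M \<theta> E D \<phi> \<infinity>"
    using that
    unfolding admits_dichotomy_def PInfty_eq_infinity[symmetric] ereal.case dichotomy_with_one_iff
    by blast
qed

lemma Inf_spectrum:
  assumes "- \<infinity> < Inf (dichotomy_spectrum M \<theta> E D \<phi>)"
  shows "Inf (dichotomy_spectrum M \<theta> E D \<phi>) = Sup (ereal ` {\<gamma>. growth_bound (- 1) \<gamma>})"
  unfolding dichotomy_spectrum_def
proof (rule Inf_complement_eq_Sup)
  show "u' \<in> {\<gamma>. growth_bound (- 1) \<gamma>}" if "u \<in> {\<gamma>. growth_bound (- 1) \<gamma>}" "u' \<le> u" for u u'
    using that growth_bound_mono[of "- 1" u u'] by simp
  show "\<exists>u'\<in>{\<gamma>. growth_bound (- 1) \<gamma>}. u < u'" if "u \<in> {\<gamma>. growth_bound (- 1) \<gamma>}" for u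
  proof -
    from that have "growth_bound (- 1) u"
      by simp
    then obtain \<delta> where "\<delta> > 0" "growth_bound (- 1) (u - - 1 * \<delta>)"
      by (rule growth_bound_open)
    then show ?thesis
      by (intro bexI[of _ "u + \<delta>"]) auto
  qed
  show "- \<infinity> < Inf {\<gamma>. \<not> admits_dichotomy M \<theta> E D \<phi> \<gamma>}"
    using assms unfolding dichotomy_spectrum_def .
  show "admits_dichotomy M \<theta> E D \<phi> (ereal u)" if "u \<in> {\<gamma>. growth_bound (- 1) \<gamma>}" for u
    unfolding admits_dichotomy_def ereal.case
    by (rule exI[of _ "\<lambda>_. 0"]) (use that in \<open>simp add: dichotomy_with_zero_iff\<close>)
  show "g \<in> {\<gamma>. growth_bound (- 1) \<gamma>}"
    if "admits_dichotomy M \<theta> E D \<phi> (ereal g)" "\<forall>g'<g. g' \<in> {\<gamma>. growth_bound (- 1) \<gamma>}" for g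
  proof -
    from that(1) obtain P where "dichotomy_with M \<theta> E D \<phi> g P"
      unfolding admits_dichotomy_def by auto
    from growth_bound_minus_closed[OF this] that(2) show ?thesis
      by simp
  qed
  show "{\<gamma>. growth_bound (- 1) \<gamma>} \<noteq> {}" if "admits_dichotomy M \<theta> E D \<phi> (- \<infinity>)"
    using that
    unfolding admits_dichotomy_def MInfty_eq_minfinity[symmetric] ereal.case dichotomy_with_zero_iff
    by blast
qed

section \<open>From exponents at a single time back to growth bounds\<close>

lemma upper_ftle_ge:
  assumes "t > 0"
  shows "Inf (ereal ` {\<gamma>. growth_bound 1 \<gamma>}) \<le> upper_ftle t"
proof (rule ccontr)
  assume "\<not> ?thesis"
  then have "upper_ftle t < Inf (ereal ` {\<gamma>. growth_bound 1 \<gamma>})"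
    by simp
  \<comment> \<open>\<open>b\<close> bounds the exponents at time \<open>t\<close>, and
    \<open>c > b\<close> leaves the gap that \<open>growth_bound_of_step\<close> requires. The
    contradiction is that \<open>c\<close> lies below the infimum of the rates with a growth
    bound.\<close>
  then obtain b where b: "upper_ftle t < ereal b" "ereal b < Inf (ereal ` {\<gamma>. growth_bound 1 \<gamma>})"
    using ereal_dense2 by blast
  then obtain c where c: "ereal b < ereal c" "ereal c < Inf (ereal ` {\<gamma>. growth_bound 1 \<gamma>})"
    using ereal_dense2 by blast
  \<comment> \<open>The bound is phrased as membership in a closed set of matrices in order to pass
    from each \<open>x\<close> almost surely to almost surely all \<open>x\<close>.\<close>
  let ?C = "{A::real^'n^'n. \<forall>v. norm (A *v v) \<le> exp (b * t) * norm v}"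
  have "closed ?C"
    by (intro closed_Collect_all closed_Collect_le continuous_on_norm continuous_matrix_vector_mult_left
      continuous_on_const)
  moreover have "\<forall>x\<in>E. AE \<omega> in M. alive t \<omega> x \<longrightarrow> \<Phi> t \<omega> x \<in> ?C"
  proof
    fix x assume x: "x \<in> E"
    have "esssup_on M {\<omega>\<in>space M. Tp \<omega> x > ereal t}
        (\<lambda>\<omega>. SUP v\<in>{v. v \<noteq> 0}. ereal (ftle \<phi> v t \<omega> x)) \<le> upper_ftle t"
      unfolding upper_ftle_def by (rule SUP_upper[OF x])
    from AE_of_esssup_on_less[OF le_less_trans[OF this b(1)]] AE_lin_cocycle_nonzero[of t] AE_space
    show "AE \<omega> in M. alive t \<omega> x \<longrightarrow> \<Phi> t \<omega> x \<in> ?C"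
    proof eventually_elim
      case (elim \<omega>)
      show ?case
      proof (intro impI CollectI allI)
        fix v assume al: "alive t \<omega> x"
        then have *: "(SUP v\<in>{v. v \<noteq> 0}. ereal (ftle \<phi> v t \<omega> x)) \<le> ereal b"
          using elim(1,3) assms x by (simp add: alive_iff_less_T_plus)
        show "norm (\<Phi> t \<omega> x *v v) \<le> exp (b * t) * norm v"
        proof (cases "v = 0")
          case False
          then have "ereal (ftle \<phi> v t \<omega> x) \<le> ereal b"
            by (intro order_trans[OF SUP_upper *]) simp
          then show ?thesis
            using elim(2) x al False assms by (simp add: ftle_le_iff)
        qed simp
      qed
    qed
  qed
  ultimately have "AE \<omega> in M. \<forall>x\<in>E. alive t \<omega> x \<longrightarrow> mat_norm (\<Phi> t \<omega> x) \<le> exp (b * t)"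
    using AE_forall_of_forall_AE[OF _ assms, of ?C] by (simp add: mat_norm_le_iff)
  then have "growth_bound 1 c"
    by (rule growth_bound_of_step[rotated 3]) (use assms c(1) in auto)
  then have "Inf (ereal ` {\<gamma>. growth_bound 1 \<gamma>}) \<le> ereal c"
    by (intro Inf_lower) auto
  with c(2) show False
    by simp
qed

lemma lower_ftle_le:
  assumes "t > 0"
  shows "lower_ftle t \<le> Sup (ereal ` {\<gamma>. growth_bound (- 1) \<gamma>})"
proof (rule ccontr)
  assume "\<not> ?thesis"
  then have "Sup (ereal ` {\<gamma>. growth_bound (- 1) \<gamma>}) < lower_ftle t"
    by simp
  then obtain b where b: "Sup (ereal ` {\<gamma>. growth_bound (- 1) \<gamma>}) < ereal b" "ereal b < lower_ftle t"
    using ereal_dense2 by blast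
  then obtain c where c: "Sup (ereal ` {\<gamma>. growth_bound (- 1) \<gamma>}) < ereal c" "ereal c < ereal b"
    using ereal_dense2 by blast
  let ?C = "{A::real^'n^'n. \<forall>v. exp (b * t) * norm v \<le> norm (A *v v)}"
  have "closed ?C"
    by (intro closed_Collect_all closed_Collect_le continuous_on_norm continuous_matrix_vector_mult_left
      continuous_on_const)
  moreover have "\<forall>x\<in>E. AE \<omega> in M. alive t \<omega> x \<longrightarrow> \<Phi> t \<omega> x \<in> ?C"
  proof
    fix x assume x: "x \<in> E"
    have "lower_ftle t \<le> essinf_on M {\<omega>\<in>space M. Tp \<omega> x > ereal t}
        (\<lambda>\<omega>. INF v\<in>{v. v \<noteq> 0}. ereal (ftle \<phi> v t \<omega> x))"
      unfolding lower_ftle_def by (rule INF_lower[OF x])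
    from AE_of_less_essinf_on[OF less_le_trans[OF b(2) this]] AE_lin_cocycle_nonzero[of t] AE_space
    show "AE \<omega> in M. alive t \<omega> x \<longrightarrow> \<Phi> t \<omega> x \<in> ?C"
    proof eventually_elim
      case (elim \<omega>)
      show ?case
      proof (intro impI CollectI allI)
        fix v assume al: "alive t \<omega> x"
        then have *: "ereal b \<le> (INF v\<in>{v. v \<noteq> 0}. ereal (ftle \<phi> v t \<omega> x))"
          using elim(1,3) assms x by (simp add: alive_iff_less_T_plus)
        show "exp (b * t) * norm v \<le> norm (\<Phi> t \<omega> x *v v)"
        proof (cases "v = 0")
          case False
          then have "ereal b \<le> ereal (ftle \<phi> v t \<omega> x)"
            by (intro order_trans[OF * INF_lower]) simp
          then show ?thesis
            using elim(2) x al False assms by (simp add: ftle_ge_iff)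
        qed simp
      qed
    qed
  qed
  ultimately have *: "AE \<omega> in M. \<forall>x\<in>E. alive t \<omega> x \<longrightarrow> \<Phi> t \<omega> x \<in> ?C"
    using AE_forall_of_forall_AE[OF _ assms] by blast
  \<comment> \<open>The expansion over positive time \<open>t\<close> is applied at the state
    reached from \<open>x\<close> at time \<open>-t\<close>; there \<open>\<Phi> t\<close> inverts
    \<open>\<Phi> (- t)\<close>, which turns expansion into a contraction estimate for the step
    \<open>-t\<close>.\<close>
  have "AE \<omega> in M. \<forall>x\<in>E. alive (- t) \<omega> x \<longrightarrow> mat_norm (\<Phi> (- t) \<omega> x) \<le> exp (b * - t)"
    using AE_flow[OF *, of "- t"] AE_regular AE_flow[OF AE_regular, of "- t"]
  proof eventually_elim
    case (elim \<omega>)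
    show ?case
    proof (intro ballI impI, unfold mat_norm_le_iff, intro allI)
      fix x v assume x: "x \<in> E" "alive (- t) \<omega> x"
      let ?A = "\<Phi> t (\<theta> (- t) \<omega>) (\<phi> (- t) \<omega> x)"
      have "?A \<in> ?C"
        using elim(1) alive_in_E[OF elim(2) x] alive_inverse[OF elim(2,3) x] by simp
      then have "exp (b * t) * norm (\<Phi> (- t) \<omega> x *v v) \<le> norm (?A *v (\<Phi> (- t) \<omega> x *v v))"
        by blast
      also have "\<dots> = norm v"
        using lin_cocycle_inverse[OF elim(2,3) x] by (simp add: matrix_vector_mul_assoc)
      finally show "norm (\<Phi> (- t) \<omega> x *v v) \<le> exp (b * - t) * norm v"
        by (simp add: exp_minus field_simps)
    qed
  qed
  then have "growth_bound (- 1) c"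
    by (rule growth_bound_of_step[rotated 3]) (use assms c(2) in auto)
  then have "ereal c \<le> Sup (ereal ` {\<gamma>. growth_bound (- 1) \<gamma>})"
    by (intro Sup_upper) auto
  with c(1) show False
    by simp
qed

section \<open>Passage to the limit\<close>

lemma upper_ftle_tendsto:
  assumes "Sup (dichotomy_spectrum M \<theta> E D \<phi>) < \<infinity>"
  shows "(upper_ftle \<longlongrightarrow> Sup (dichotomy_spectrum M \<theta> E D \<phi>)) at_top"
  unfolding Sup_spectrum[OF assms]
  using upper_ftle_ge eventually_upper_ftle_le by (intro tendsto_Inf_at_top) auto

lemma lower_ftle_tendsto:
  assumes "- \<infinity> < Inf (dichotomy_spectrum M \<theta> E D \<phi>)"
  shows "(lower_ftle \<longlongrightarrow> Inf (dichotomy_spectrum M \<theta> E D \<phi>)) at_top"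
  unfolding Inf_spectrum[OF assms]
  using lower_ftle_le eventually_lower_ftle_ge by (intro tendsto_Sup_at_top) auto

end

theorem theorem4p10:
  fixes M :: "'w measure"
    and \<theta> :: "real \<Rightarrow> 'w \<Rightarrow> 'w"
    and E :: "(real^'n) set"
    and D :: "(real \<times> 'w \<times> (real^'n)) set"
    and \<phi> :: "real \<Rightarrow> 'w \<Rightarrow> real^'n \<Rightarrow> real^'n"
  assumes "prob_space M"
    and "measure_preserving_flow M \<theta>"
    and "open E" and "bounded E"
    and "local_C1_rds M \<theta> E D \<phi>"
    and domain_interval:
      "\<forall>x\<in>E. AE \<omega> in M. is_interval {t. (t, \<omega>, x) \<in> D} \<and> 0 \<in> interior {t. (t, \<omega>, x) \<in> D}"
    and domain_hitting_times:
      "AE \<omega> in M. \<forall>x\<in>E. \<forall>t. T_minus E D \<phi> \<omega> x < ereal t \<and> ereal t < T_plus E D \<phi> \<omega> x \<longrightarrow>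
         (t, \<omega>, x) \<in> D"
    and T_plus_finite: "\<forall>x\<in>E. AE \<omega> in M. T_plus E D \<phi> \<omega> x < \<infinity>"
    and T_minus_finite: "\<forall>x\<in>E. AE \<omega> in M. T_minus E D \<phi> \<omega> x > -\<infinity>"
    and T_plus_unbounded:
      "\<forall>x\<in>E. \<forall>t\<ge>0. measure M {\<omega>\<in>space M. T_plus E D \<phi> \<omega> x > ereal t} > 0"
    and T_minus_unbounded:
      "\<forall>x\<in>E. \<forall>t\<le>0. measure M {\<omega>\<in>space M. T_minus E D \<phi> \<omega> x < ereal t} > 0"
    and boundedness:
      "\<forall>ts>0. \<exists>B>0. AE \<omega> in M. \<forall>x\<in>E. \<forall>t.
         (t, \<omega>, x) \<in> D \<and>
         max (ereal (- ts)) (T_minus E D \<phi> \<omega> x) \<le> ereal t \<and>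
         ereal t \<le> min (ereal ts) (T_plus E D \<phi> \<omega> x) \<longrightarrow>
         mat_norm (lin_cocycle \<phi> t \<omega> x) \<le> B"
  shows "(Sup (dichotomy_spectrum M \<theta> E D \<phi>) < \<infinity> \<longrightarrow>
           ((\<lambda>t::real. SUP x\<in>E. esssup_on M {\<omega>\<in>space M. T_plus E D \<phi> \<omega> x > ereal t}
                         (\<lambda>\<omega>. SUP v\<in>{v. v \<noteq> 0}. ereal (ftle \<phi> v t \<omega> x)))
             \<longlongrightarrow> Sup (dichotomy_spectrum M \<theta> E D \<phi>)) at_top) \<and>
         (Inf (dichotomy_spectrum M \<theta> E D \<phi>) > -\<infinity> \<longrightarrow>
           ((\<lambda>t::real. INF x\<in>E. essinf_on M {\<omega>\<in>space M. T_plus E D \<phi> \<omega> x > ereal t}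
                         (\<lambda>\<omega>. INF v\<in>{v. v \<noteq> 0}. ereal (ftle \<phi> v t \<omega> x)))
             \<longlongrightarrow> Inf (dichotomy_spectrum M \<theta> E D \<phi>)) at_top)"
proof -
  interpret hitting_rds M \<theta> E D \<phi>
    by unfold_locales (fact assms)+
  show ?thesis
    using upper_ftle_tendsto lower_ftle_tendsto
    unfolding upper_ftle_def[abs_def] lower_ftle_def[abs_def] by blast
qed

end
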